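(* Let $\mathcal{H}$ be a 3-uniform, 3-partite hypergraph, let $k$ be a field, and let $I=I(\mathcal{H})\subseteq k[V(\mathcal{H})]$ be its edge ideal. Then $$I^{(2)}=I^2+\Bigl(\prod_{x\in V(\mathcal{B})}x \;:\; \mathcal{B}\text{ is a bad subhypergraph of length 3 of }\mathcal{H}\Bigr).$$
   Context: A (simple) hypergraph on a finite set $X=\{x_1,\dots,x_n\}$ of vertices is a family $\mathcal{H}=(E_1,\dots,E_q)$ of nonempty subsets of $X$ (hyperedges) with $\bigcup_i E_i=X$ and no $E_i$ contained in another; write $V(\mathcal{H})=X$. All hypergraphs are simple. $\mathcal{H}$ is $r$-uniform if every hyperedge has exactly $r$ elements. A uniform hypergraph $\mathcal{H}$ is $r$-partite if $V(\mathcal{H})=\bigcup_{i=1}^r X_i$ with $X_1,\dots,X_r$ pairwise disjoint, each $X_i$ a vertex cover of $\mathcal{H}$ (i.e. $X_i$ meets every hyperedge), and $|X_i\cap E|=1$ for every hyperedge $E$ and every $i$. Identifying vertices with variables, the edge ideal of an $r$-uniform hypergraph $\mathcal{H}$ is the squarefree monomial ideal $I(\mathcal{H})=(\prod_{x\in E}x : E\in\mathcal{H})$ in the polynomial ring $k[V(\mathcal{H})]$ over a field $k$. For an ideal $I$ in a Noetherian domain $R$, the $n$-th symbolic power is $I^{(n)}=\bigcap_{\mathfrak{p}\in \mathrm{Ass}_R(R/I)}(I^nR_{\mathfrak{p}}\cap R)$. The bad hypergraph of length 3 is the hypergraph on six distinct vertices $x_1,\dots,x_6$ with hyperedges $\{x_1,x_2,x_3\},\{x_3,x_4,x_5\},\{x_5,x_6,x_2\}$.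 A bad subhypergraph of length 3 of $\mathcal{H}$ is a subhypergraph $\mathcal{B}=\langle e,e',e''\rangle$ formed by three hyperedges $e,e',e''$ of $\mathcal{H}$ (with vertex set $V(\mathcal{B})=e\cup e'\cup e''$; not required to be induced) that is isomorphic to the bad hypergraph of length 3. *)

theory Defs
  imports
    "HOL-Library.Poly_Mapping"
    "HOL-Library.Disjoint_Sets"
    "HOL-Algebra.QuotRing"
    "HOL-Algebra.Ideal_Product"
begin

section \<open>Hypergraphs\<close>

text \<open>A hypergraph is given by its vertex set \<open>V\<close> and its set of hyperedges \<open>H\<close>.  A set suffices:
  the hyperedges of a simple hypergraph are pairwise incomparable, hence pairwise distinct.\<close>

definition simple_hypergraph :: "'v set \<Rightarrow> 'v set set \<Rightarrow> bool" where
  "simple_hypergraph V H \<longleftrightarrow>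
     finite V \<and> (\<forall>E\<in>H. E \<noteq> {} \<and> E \<subseteq> V) \<and> \<Union>H = V \<and>
     (\<forall>E\<in>H. \<forall>E'\<in>H. E \<subseteq> E' \<longrightarrow> E = E')"

definition uniform_hypergraph :: "nat \<Rightarrow> 'v set set \<Rightarrow> bool" where
  "uniform_hypergraph r H \<longleftrightarrow> (\<forall>E\<in>H. card E = r)"

definition vertex_cover :: "'v set \<Rightarrow> 'v set set \<Rightarrow> 'v set \<Rightarrow> bool" where
  "vertex_cover V H C \<longleftrightarrow> C \<subseteq> V \<and> (\<forall>E\<in>H. C \<inter> E \<noteq> {})"

definition partite_hypergraph :: "nat \<Rightarrow> 'v set \<Rightarrow> 'v set set \<Rightarrow> bool" where
  "partite_hypergraph r V H \<longleftrightarrow>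
     (\<exists>P :: nat \<Rightarrow> 'v set.
        V = (\<Union>i<r. P i) \<and> disjoint_family_on P {..<r} \<and>
        (\<forall>i<r. vertex_cover V H (P i)) \<and>
        (\<forall>i<r. \<forall>E\<in>H. card (P i \<inter> E) = 1))"

definition hypergraph_isomorphic ::
    "'v set \<Rightarrow> 'v set set \<Rightarrow> 'w set \<Rightarrow> 'w set set \<Rightarrow> bool" where
  "hypergraph_isomorphic V H Y K \<longleftrightarrow>
     (\<exists>f. bij_betw f V Y \<and> (\<lambda>E. f ` E) ` H = K)"

text \<open>The bad hypergraph of length 3, with \<open>x\<^sub>i\<close> represented by the number \<open>i\<close>.\<close>

definition bad3_vertices :: "nat set" where
  "bad3_vertices = {1, 2, 3, 4, 5, 6}"

definition bad3_edges :: "nat set set" where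
  "bad3_edges = {{1, 2, 3}, {3, 4, 5}, {5, 6, 2}}"

text \<open>A bad subhypergraph is given by its edge set \<open>B\<close>; its vertex set is \<open>\<Union>B\<close>.\<close>

definition bad3_subhypergraph :: "'v set set \<Rightarrow> 'v set set \<Rightarrow> bool" where
  "bad3_subhypergraph H B \<longleftrightarrow>
     (\<exists>e\<in>H. \<exists>e'\<in>H. \<exists>e''\<in>H. B = {e, e', e''}) \<and>
     hypergraph_isomorphic (\<Union>B) B bad3_vertices bad3_edges"


section \<open>Polynomial rings and edge ideals\<close>

text \<open>The type \<open>('v \<Rightarrow>\<^sub>0 nat) \<Rightarrow>\<^sub>0 'k\<close> carries the polynomial ring over \<open>'k\<close> in all the elements of
  \<open>'v\<close>; the ring \<open>k[V]\<close> consists of the polynomials all of whose monomials are supported in \<open>V\<close>.\<close>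

definition mpoly_ring :: "'v set \<Rightarrow> (('v \<Rightarrow>\<^sub>0 nat) \<Rightarrow>\<^sub>0 'k :: field) ring" where
  "mpoly_ring V =
     \<lparr>carrier = {p. \<forall>m \<in> Poly_Mapping.keys p. Poly_Mapping.keys m \<subseteq> V},
      mult = (*), one = 1, zero = 0, add = (+)\<rparr>"

definition mpoly_var :: "'v \<Rightarrow> (('v \<Rightarrow>\<^sub>0 nat) \<Rightarrow>\<^sub>0 'k :: field)" where
  "mpoly_var x = Poly_Mapping.single (Poly_Mapping.single x 1) 1"

definition edge_ideal :: "'v set \<Rightarrow> 'v set set \<Rightarrow> (('v \<Rightarrow>\<^sub>0 nat) \<Rightarrow>\<^sub>0 'k :: field) set" where
  "edge_ideal V H = Idl\<^bsub>mpoly_ring V\<^esub> {\<Prod>x\<in>E. mpoly_var x | E. E \<in> H}"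


section \<open>Localization\<close>

text \<open>The ring of fractions \<open>S\<inverse>R\<close>, for a multiplicative subset \<open>S\<close> of a commutative ring \<open>R\<close>:
  its elements are the classes of pairs \<open>(a, s)\<close>, standing for \<open>a/s\<close>.\<close>

definition fraction_rel :: "('a, 'b) ring_scheme \<Rightarrow> 'a set \<Rightarrow> (('a \<times> 'a) \<times> ('a \<times> 'a)) set" where
  "fraction_rel R S =
     {((a, s), (b, t)) | a s b t.
        a \<in> carrier R \<and> s \<in> S \<and> b \<in> carrier R \<and> t \<in> S \<and>
        (\<exists>u\<in>S. u \<otimes>\<^bsub>R\<^esub> (t \<otimes>\<^bsub>R\<^esub> a \<ominus>\<^bsub>R\<^esub> s \<otimes>\<^bsub>R\<^esub> b) = \<zero>\<^bsub>R\<^esub>)}"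

definition fraction :: "('a, 'b) ring_scheme \<Rightarrow> 'a set \<Rightarrow> 'a \<Rightarrow> 'a \<Rightarrow> ('a \<times> 'a) set" where
  "fraction R S a s = fraction_rel R S `` {(a, s)}"

text \<open>The unions over representatives below are unions of equal classes when \<open>R\<close> is a commutative ring and
  \<open>S\<close> is multiplicative.\<close>

definition localization :: "('a, 'b) ring_scheme \<Rightarrow> 'a set \<Rightarrow> ('a \<times> 'a) set ring" where
  "localization R S =
     \<lparr>carrier = (carrier R \<times> S) // fraction_rel R S,
      mult = (\<lambda>x y. \<Union>(a, s)\<in>x. \<Union>(b, t)\<in>y. fraction R S (a \<otimes>\<^bsub>R\<^esub> b) (s \<otimes>\<^bsub>R\<^esub> t)),
      one = fraction R S \<one>\<^bsub>R\<^esub> \<one>\<^bsub>R\<^esub>,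
      zero = fraction R S \<zero>\<^bsub>R\<^esub> \<one>\<^bsub>R\<^esub>,
      add = (\<lambda>x y. \<Union>(a, s)\<in>x. \<Union>(b, t)\<in>y.
               fraction R S (t \<otimes>\<^bsub>R\<^esub> a \<oplus>\<^bsub>R\<^esub> s \<otimes>\<^bsub>R\<^esub> b) (s \<otimes>\<^bsub>R\<^esub> t))\<rparr>"

text \<open>\<open>J R\<^sub>p\<close>, and \<open>J R\<^sub>p \<inter> R\<close>, where the intersection is the preimage under \<open>a \<mapsto> a/1\<close>
  (an injective map when \<open>R\<close> is a domain).\<close>

definition local_extension :: "('a, 'b) ring_scheme \<Rightarrow> 'a set \<Rightarrow> 'a set \<Rightarrow> ('a \<times> 'a) set set" where
  "local_extension R p J =
     Idl\<^bsub>localization R (carrier R - p)\<^esub> ((\<lambda>a. fraction R (carrier R - p) a \<one>\<^bsub>R\<^esub>) ` J)"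

definition local_contraction :: "('a, 'b) ring_scheme \<Rightarrow> 'a set \<Rightarrow> 'a set \<Rightarrow> 'a set" where
  "local_contraction R p J =
     {a \<in> carrier R. fraction R (carrier R - p) a \<one>\<^bsub>R\<^esub> \<in> local_extension R p J}"


section \<open>Symbolic powers\<close>

text \<open>The prime ideals of \<open>R\<close> that are annihilators of an element of the \<open>R\<close>-module \<open>R/I\<close>.\<close>

definition associated_primes :: "('a, 'b) ring_scheme \<Rightarrow> 'a set \<Rightarrow> 'a set set" where
  "associated_primes R I =
     {p. primeideal p R \<and>
         (\<exists>x \<in> carrier (R Quot I).
            p = {r \<in> carrier R. (I +>\<^bsub>R\<^esub> r) \<otimes>\<^bsub>R Quot I\<^esub> x = \<zero>\<^bsub>R Quot I\<^esub>})}"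

definition ideal_power :: "('a, 'b) ring_scheme \<Rightarrow> 'a set \<Rightarrow> nat \<Rightarrow> 'a set" where
  "ideal_power R I n = I [^]\<^bsub>ideals_set R\<^esub> n"

definition symbolic_power :: "('a, 'b) ring_scheme \<Rightarrow> 'a set \<Rightarrow> nat \<Rightarrow> 'a set" where
  "symbolic_power R I n =
     {a \<in> carrier R. \<forall>p \<in> associated_primes R I. a \<in> local_contraction R p (ideal_power R I n)}"

end

theory Submission
  imports Defs
begin

text \<open>A prime associated to the squarefree monomial ideal \<open>I\<close> contains exactly the variables of a
  minimal vertex cover \<open>C\<close>, and localizing there turns membership in \<open>I\<^sup>2\<close> into the condition that
  every monomial has degree at least 2 in the variables of \<open>C\<close>.  So \<open>I\<^sup>(\<^sup>2\<^sup>)\<close> is spanned by the monomials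
  \<open>m\<close> of degree at least 2 in every vertex cover.  If no product of two edges divides such an \<open>m\<close>, any
  two edges dividing \<open>m\<close> share a vertex of exponent 1, while no vertex of exponent 1 lies on all
  of these edges.  In a 3-partite hypergraph this yields two edges sharing exactly one such vertex
  \<open>a\<close>; an edge missing \<open>a\<close> completes a bad triangle dividing \<open>m\<close>.\<close>

section \<open>Localization at a prime\<close>

text \<open>If \<open>e\<close> and \<open>f\<close> divide \<open>m\<close> but their product does
  not, the failure occurs at a common vertex, where the product has exponent 2 and \<open>m\<close>
  exactly 1. A vertex of exponent 1 on all edges dividing \<open>m\<close> would form, with the
  vertices of exponent 0, a cover in which \<open>m\<close> has degree 1. Such covers need not be
  minimal, so the degree condition is wanted for all covers, while associated primes supply it for
  minimal ones; the two versions agree because the degree can only grow with the cover.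

  The algebraic obstacle is the denominators, which are arbitrary polynomials outside a prime. The
  degree in the variables of a cover is additive on monomials, and the least degree of a product is
  the sum of the least degrees. A denominator with a term of degree 0 therefore cannot raise the
  least degree of what it multiplies. In the other direction one explicit monomial denominator,
  built from the variables outside the cover, is enough.\<close>

locale type_cring = cring R for R :: "'a::comm_ring_1 ring" (structure) +
  assumes mult_eq [simp]: "mult R = (*)" and one_eq [simp]: "one R = 1"
    and zero_eq [simp]: "zero R = 0" and add_eq [simp]: "add R = (+)"
begin

lemmas type_closed =
  m_closed[unfolded mult_eq] a_closed[unfolded add_eq] one_closed[unfolded one_eq]
  zero_closed[unfolded zero_eq]

lemma a_inv_eq: "x \<in> carrier R \<Longrightarrow> \<ominus> x = - x"
  using r_neg[of x] by (simp add: eq_neg_iff_add_eq_0 add.commute)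

lemma uminus_closed: "x \<in> carrier R \<Longrightarrow> - x \<in> carrier R"
  using a_inv_closed[of x] by (simp add: a_inv_eq)

lemma a_minus_eq: "x \<in> carrier R \<Longrightarrow> y \<in> carrier R \<Longrightarrow> x \<ominus> y = x - y"
  by (simp add: a_minus_def a_inv_eq)

text \<open>Closure under negation is absent from the premises because it is multiplication by the
  carrier element \<open>- 1\<close>.\<close>

lemma type_idealI:
  assumes "K \<subseteq> carrier R" "0 \<in> K" "\<And>x y. x \<in> K \<Longrightarrow> y \<in> K \<Longrightarrow> x + y \<in> K"
    and "\<And>x r. x \<in> K \<Longrightarrow> r \<in> carrier R \<Longrightarrow> r * x \<in> K"
  shows "ideal K R"
proof (rule idealI)
  show "subgroup K (add_monoid R)"
  proof (rule add.subgroupI)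
    fix x assume x: "x \<in> K"
    then have "- 1 * x \<in> K"
      using assms(4) uminus_closed type_closed(3) by blast
    then show "\<ominus> x \<in> K"
      using x assms(1) by (simp add: a_inv_eq subset_iff)
  qed (use assms in auto)
qed (use assms ring_axioms in \<open>auto simp: mult.commute\<close>)

end

section \<open>Rings of fractions and extended ideals\<close>

locale multiplicative_subset = type_cring +
  fixes S
  assumes S_subset: "S \<subseteq> carrier R" and S_one: "1 \<in> S"
    and S_mult: "s \<in> S \<Longrightarrow> t \<in> S \<Longrightarrow> s * t \<in> S"
begin

abbreviation "frac \<equiv> fraction R S"
abbreviation "L \<equiv> localization R S"

lemma S_carrier: "s \<in> S \<Longrightarrow> s \<in> carrier R"
  using S_subset by blast

lemmas closure_rules = type_closed S_carrier S_one S_mult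

lemma fraction_rel_iff:
  "((a, s), (b, t)) \<in> fraction_rel R S \<longleftrightarrow>
     a \<in> carrier R \<and> s \<in> S \<and> b \<in> carrier R \<and> t \<in> S \<and> (\<exists>u\<in>S. u * (t * a - s * b) = 0)"
  unfolding fraction_rel_def
  by (auto simp: a_minus_eq closure_rules)

lemma equiv_fraction_rel: "equiv (carrier R \<times> S) (fraction_rel R S)"
proof (rule equivI)
  show "refl_on (carrier R \<times> S) (fraction_rel R S)"
    by (rule refl_onI) (use S_one in \<open>auto simp: fraction_rel_iff\<close>)
  show "sym (fraction_rel R S)"
  proof (rule symI, clarify)
    fix a s b t assume "((a, s), (b, t)) \<in> fraction_rel R S"
    then obtain u where u: "a \<in> carrier R" "s \<in> S" "b \<in> carrier R" "t \<in> S" "u \<in> S"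
      "u * (t * a - s * b) = 0"
      by (auto simp: fraction_rel_iff)
    then have "u * (s * b - t * a) = 0"
      by (simp add: algebra_simps)
    with u show "((b, t), (a, s)) \<in> fraction_rel R S"
      by (auto simp: fraction_rel_iff)
  qed
  show "trans (fraction_rel R S)"
  proof (rule transI, clarify)
    fix a s b t c r
    assume "((a, s), (b, t)) \<in> fraction_rel R S" "((b, t), (c, r)) \<in> fraction_rel R S"
    then obtain u v where u: "a \<in> carrier R" "s \<in> S" "b \<in> carrier R" "t \<in> S" "u \<in> S"
      "u * (t * a - s * b) = 0"
      and v: "c \<in> carrier R" "r \<in> S" "v \<in> S" "v * (r * b - t * c) = 0"
      by (auto simp: fraction_rel_iff)
    \<comment> \<open>The factor \<open>t\<close> of the multiplier makes the terms in
      \<open>b\<close> cancel, so transitivity holds even in the presence of zero divisors.\<close>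
    have "(u * v * t) * (r * a - s * c) = v * r * (u * (t * a - s * b)) + u * s * (v * (r * b - t * c))"
      by (simp add: algebra_simps)
    then have "(u * v * t) * (r * a - s * c) = 0"
      using u v by simp
    moreover have "u * v * t \<in> S"
      using u v S_mult by blast
    ultimately show "((a, s), (c, r)) \<in> fraction_rel R S"
      using u v by (auto simp: fraction_rel_iff)
  qed
qed (auto simp: fraction_rel_iff)

lemma frac_eq_iff:
  assumes "a \<in> carrier R" "s \<in> S" "b \<in> carrier R" "t \<in> S"
  shows "frac a s = frac b t \<longleftrightarrow> (\<exists>u\<in>S. u * (t * a - s * b) = 0)"
  unfolding fraction_def
  using eq_equiv_class_iff[OF equiv_fraction_rel, of "(a, s)" "(b, t)"] assms
  by (simp add: fraction_rel_iff)

lemma mem_frac_iff: "(b, t) \<in> frac a s \<longleftrightarrow> ((a, s), (b, t)) \<in> fraction_rel R S"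
  by (simp add: fraction_def)

lemma frac_cong:
  assumes "a \<in> carrier R" "s \<in> S" "b \<in> carrier R" "t \<in> S" "t * a = s * b"
  shows "frac a s = frac b t"
  using assms S_one by (auto simp: frac_eq_iff)

lemma carrier_localization: "carrier L = {frac a s | a s. a \<in> carrier R \<and> s \<in> S}"
  unfolding localization_def quotient_def fraction_def by auto

lemma frac_in_carrier: "a \<in> carrier R \<Longrightarrow> s \<in> S \<Longrightarrow> frac a s \<in> carrier L"
  by (auto simp: carrier_localization)

text \<open>The product is defined as a union over all representatives. It collapses to one class
  because the classes in the union coincide: multipliers \<open>u\<close> and \<open>v\<close>
  witnessing the two changes of representative combine to \<open>u * v\<close>.\<close>

lemma mult_frac:
  assumes "a \<in> carrier R" "s \<in> S" "b \<in> carrier R" "t \<in> S"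
  shows "frac a s \<otimes>\<^bsub>L\<^esub> frac b t = frac (a * b) (s * t)"
proof -
  have "frac (a' * b') (s' * t') = frac (a * b) (s * t)"
    if "(a', s') \<in> frac a s" "(b', t') \<in> frac b t" for a' s' b' t'
  proof -
    from that obtain u v where u: "a' \<in> carrier R" "s' \<in> S" "u \<in> S" "u * (s' * a - s * a') = 0"
      and v: "b' \<in> carrier R" "t' \<in> S" "v \<in> S" "v * (t' * b - t * b') = 0"
      by (auto simp: mem_frac_iff fraction_rel_iff)
    have "(u * v) * ((s' * t') * (a * b) - (s * t) * (a' * b'))
      = v * t' * b * (u * (s' * a - s * a')) + u * s * a' * (v * (t' * b - t * b'))"
      by (simp add: algebra_simps)
    then have "(u * v) * ((s' * t') * (a * b) - (s * t) * (a' * b')) = 0"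
      using u v by simp
    with u v assms S_mult show ?thesis
      by (subst eq_commute, subst frac_eq_iff) (auto simp: closure_rules)
  qed
  moreover have "(a, s) \<in> frac a s" "(b, t) \<in> frac b t"
    using assms S_one by (auto simp: mem_frac_iff fraction_rel_iff)
  ultimately have "(\<Union>(a', s')\<in>frac a s. \<Union>(b', t')\<in>frac b t. frac (a' * b') (s' * t')) =
      frac (a * b) (s * t)"
    by fast
  then show ?thesis
    by (simp add: localization_def)
qed

lemma add_frac:
  assumes "a \<in> carrier R" "s \<in> S" "b \<in> carrier R" "t \<in> S"
  shows "frac a s \<oplus>\<^bsub>L\<^esub> frac b t = frac (t * a + s * b) (s * t)"
proof -
  have "frac (t' * a' + s' * b') (s' * t') = frac (t * a + s * b) (s * t)"
    if "(a', s') \<in> frac a s" "(b', t') \<in> frac b t" for a' s' b' t'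
  proof -
    from that obtain u v where u: "a' \<in> carrier R" "s' \<in> S" "u \<in> S" "u * (s' * a - s * a') = 0"
      and v: "b' \<in> carrier R" "t' \<in> S" "v \<in> S" "v * (t' * b - t * b') = 0"
      by (auto simp: mem_frac_iff fraction_rel_iff)
    have "(u * v) * ((s' * t') * (t * a + s * b) - (s * t) * (t' * a' + s' * b'))
      = v * t' * t * (u * (s' * a - s * a')) + u * s * s' * (v * (t' * b - t * b'))"
      by (simp add: algebra_simps)
    then have "(u * v) * ((s' * t') * (t * a + s * b) - (s * t) * (t' * a' + s' * b')) = 0"
      using u v by simp
    with u v assms S_mult show ?thesis
      by (subst eq_commute, subst frac_eq_iff) (auto simp: closure_rules)
  qed
  moreover have "(a, s) \<in> frac a s" "(b, t) \<in> frac b t"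
    using assms S_one by (auto simp: mem_frac_iff fraction_rel_iff)
  ultimately have "(\<Union>(a', s')\<in>frac a s. \<Union>(b', t')\<in>frac b t. frac (t' * a' + s' * b') (s' * t')) =
      frac (t * a + s * b) (s * t)"
    by fast
  then show ?thesis
    by (simp add: localization_def)
qed

lemma one_localization: "\<one>\<^bsub>L\<^esub> = frac 1 1" and zero_localization: "\<zero>\<^bsub>L\<^esub> = frac 0 1"
  by (simp_all add: localization_def)

lemmas frac_simps = mult_frac add_frac one_localization zero_localization frac_in_carrier closure_rules

lemma localization_cases:
  assumes "x \<in> carrier L"
  obtains a s where "x = frac a s" "a \<in> carrier R" "s \<in> S" "s \<in> carrier R"
  using assms S_carrier by (auto simp: carrier_localization)

lemma ring_localization: "ring L"
proof -
  note rules = mult_frac add_frac one_localization zero_localization frac_in_carrier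
    type_closed S_one S_mult
  note cases = localization_cases
  show ?thesis
  proof (rule ringI)
    show "abelian_group L"
    proof (rule abelian_groupI)
      fix x assume x: "x \<in> carrier L"
      show "\<exists>y\<in>carrier L. y \<oplus>\<^bsub>L\<^esub> x = \<zero>\<^bsub>L\<^esub>"
        using x
      proof (rule cases)
        fix a s assume "x = frac a s" "a \<in> carrier R" "s \<in> S" "s \<in> carrier R"
        then have "frac (- a) s \<in> carrier L" "frac (- a) s \<oplus>\<^bsub>L\<^esub> x = \<zero>\<^bsub>L\<^esub>"
          by (auto simp: rules uminus_closed intro!: frac_cong del: equalityI)
        then show ?thesis by blast
      qed
      show "\<zero>\<^bsub>L\<^esub> \<oplus>\<^bsub>L\<^esub> x = x"
        using x by (rule cases) (simp add: rules)
      fix y assume y: "y \<in> carrier L"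
      show "x \<oplus>\<^bsub>L\<^esub> y \<in> carrier L"
        using x y by (elim cases) (simp add: rules)
      show "x \<oplus>\<^bsub>L\<^esub> y = y \<oplus>\<^bsub>L\<^esub> x"
        using x y by (elim cases) (simp add: rules mult.commute add.commute)
      fix z assume z: "z \<in> carrier L"
      show "x \<oplus>\<^bsub>L\<^esub> y \<oplus>\<^bsub>L\<^esub> z = x \<oplus>\<^bsub>L\<^esub> (y \<oplus>\<^bsub>L\<^esub> z)"
        using x y z by (elim cases) (simp add: rules, simp add: algebra_simps)
    qed (simp add: rules)
    show "Group.monoid L"
    proof (rule monoidI)
      fix x assume x: "x \<in> carrier L"
      show "\<one>\<^bsub>L\<^esub> \<otimes>\<^bsub>L\<^esub> x = x" "x \<otimes>\<^bsub>L\<^esub> \<one>\<^bsub>L\<^esub> = x"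
        using x by (auto elim!: cases simp: rules)
      fix y assume y: "y \<in> carrier L"
      show "x \<otimes>\<^bsub>L\<^esub> y \<in> carrier L"
        using x y by (elim cases) (simp add: rules)
      fix z assume z: "z \<in> carrier L"
      show "x \<otimes>\<^bsub>L\<^esub> y \<otimes>\<^bsub>L\<^esub> z = x \<otimes>\<^bsub>L\<^esub> (y \<otimes>\<^bsub>L\<^esub> z)"
        using x y z by (elim cases) (simp add: rules, simp add: mult.assoc)
    qed (simp add: rules)
    fix x y z assume xyz: "x \<in> carrier L" "y \<in> carrier L" "z \<in> carrier L"
    have comm: "u \<otimes>\<^bsub>L\<^esub> v = v \<otimes>\<^bsub>L\<^esub> u" if "u \<in> carrier L" "v \<in> carrier L" for u v
      using that by (elim cases) (simp add: rules mult.commute)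
    \<comment> \<open>In contrast to associativity, the two sides have different denominators: the
      right one carries the denominator of \<open>z\<close> twice. Hence an equality of fractions is
      proved instead of one of representatives.\<close>
    show distr: "(x \<oplus>\<^bsub>L\<^esub> y) \<otimes>\<^bsub>L\<^esub> z = x \<otimes>\<^bsub>L\<^esub> z \<oplus>\<^bsub>L\<^esub> y \<otimes>\<^bsub>L\<^esub> z"
      using xyz by (elim cases) (simp add: rules, rule frac_cong,
        simp_all add: rules, simp add: algebra_simps)
    have "x \<oplus>\<^bsub>L\<^esub> y \<in> carrier L"
      using xyz by (elim cases) (simp add: rules)
    with distr xyz show "z \<otimes>\<^bsub>L\<^esub> (x \<oplus>\<^bsub>L\<^esub> y) = z \<otimes>\<^bsub>L\<^esub> x \<oplus>\<^bsub>L\<^esub> z \<otimes>\<^bsub>L\<^esub> y"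
      by (simp add: comm)
  qed
qed

text \<open>This set contains the image of \<open>J\<close>, so it bounds the extended ideal from
  above, and membership in the extension can be read off a single fraction.\<close>

lemma ideal_fractions:
  assumes "ideal J R"
  shows "ideal {frac j s | j s. j \<in> J \<and> s \<in> S} L"
proof -
  interpret J: ideal J R by fact
  have J: "0 \<in> J" "\<And>x. x \<in> J \<Longrightarrow> x \<in> carrier R" "\<And>x y. x \<in> J \<Longrightarrow> y \<in> J \<Longrightarrow> x + y \<in> J"
    "\<And>x r. x \<in> J \<Longrightarrow> r \<in> carrier R \<Longrightarrow> r * x \<in> J" "\<And>x r. x \<in> J \<Longrightarrow> r \<in> carrier R \<Longrightarrow> x * r \<in> J"
    using J.zero_closed J.a_closed J.I_l_closed J.I_r_closed J.Icarr by auto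
  interpret L: ring L by (rule ring_localization)
  let ?K = "{frac j s | j s. j \<in> J \<and> s \<in> S}"
  show ?thesis
  proof (rule idealI[OF ring_localization])
    show "subgroup ?K (add_monoid L)"
    proof (rule L.add.subgroupI)
      show "?K \<subseteq> carrier L" using J(2) frac_in_carrier by blast
      show "?K \<noteq> {}" using J(1) S_one by blast
      fix x assume "x \<in> ?K"
      then obtain j s where x: "x = frac j s" "j \<in> J" "s \<in> S" by blast
      have "frac (- 1 * j) s \<oplus>\<^bsub>L\<^esub> x = \<zero>\<^bsub>L\<^esub>" 
        using x by (auto simp: add_frac zero_localization J(2) uminus_closed type_closed S_one S_mult
            intro!: frac_cong del: equalityI)
      then have "\<ominus>\<^bsub>L\<^esub> x = frac (- 1 * j) s"
        using x by (intro L.minus_equality) (auto simp: frac_in_carrier J(2) uminus_closed type_closed)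
      moreover have "- 1 * j \<in> J" using x J(4) uminus_closed type_closed(3) by blast
      ultimately show "\<ominus>\<^bsub>L\<^esub> x \<in> ?K" using x by blast
      fix y assume "y \<in> ?K"
      then obtain i t where y: "y = frac i t" "i \<in> J" "t \<in> S" by blast
      have "x \<oplus>\<^bsub>L\<^esub> y = frac (t * j + s * i) (s * t)"
        using x y by (simp add: add_frac J(2))
      moreover have "t * j + s * i \<in> J" "s * t \<in> S"
        using x y by (auto intro!: J(3,4) S_mult S_carrier)
      ultimately show "x \<oplus>\<^bsub>L\<^esub> y \<in> ?K" by blast
    qed
    fix x y assume "x \<in> ?K" "y \<in> carrier L"
    then obtain j s b t where xy: "x = frac j s" "j \<in> J" "s \<in> S" "y = frac b t" "b \<in> carrier R" "t \<in> S"
      by (auto simp: carrier_localization)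
    then have "y \<otimes>\<^bsub>L\<^esub> x = frac (b * j) (t * s)" "x \<otimes>\<^bsub>L\<^esub> y = frac (j * b) (s * t)"
      by (simp_all add: mult_frac J(2))
    moreover have "b * j \<in> J" "j * b \<in> J" "s * t \<in> S" "t * s \<in> S"
      using xy J(4)[of j b] J(5)[of j b] by (auto intro!: S_mult)
    ultimately show "y \<otimes>\<^bsub>L\<^esub> x \<in> ?K" "x \<otimes>\<^bsub>L\<^esub> y \<in> ?K"
      by blast+
  qed
qed

text \<open>If \<open>a/1 = j/s\<close>, then \<open>(u * s) * a = u * j\<close> for some
  \<open>u\<close> in \<open>S\<close>, which lies in \<open>J\<close>. Conversely,
  \<open>a/1\<close> is \<open>1/s\<close> times the image of \<open>s * a\<close>. After this,
  fractions can be replaced by a condition inside \<open>R\<close>.\<close>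

lemma frac_in_extension_iff:
  assumes "ideal J R" "a \<in> carrier R"
  shows "frac a 1 \<in> Idl\<^bsub>L\<^esub> ((\<lambda>j. frac j 1) ` J) \<longleftrightarrow> (\<exists>s\<in>S. s * a \<in> J)"
proof
  interpret J: ideal J R by fact
  interpret L: ring L by (rule ring_localization)
  {
    assume "frac a 1 \<in> Idl\<^bsub>L\<^esub> ((\<lambda>j. frac j 1) ` J)"
    moreover have "Idl\<^bsub>L\<^esub> ((\<lambda>j. frac j 1) ` J) \<subseteq> {frac j s | j s. j \<in> J \<and> s \<in> S}"
      using ideal_fractions[OF assms(1)] S_one by (intro L.genideal_minimal) auto
    ultimately obtain j s where j: "frac a 1 = frac j s" "j \<in> J" "s \<in> S"
      by blast
    then obtain u where u: "u \<in> S" "u * (s * a - j) = 0"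
      using assms by (auto simp: frac_eq_iff J.Icarr closure_rules)
    then have "(u * s) * a = u * j"
      by (simp add: algebra_simps)
    also have "u * j \<in> J"
      using J.I_l_closed[of j u] u j by (simp add: closure_rules)
    finally show "\<exists>s\<in>S. s * a \<in> J"
      using u j S_mult by blast
  }
  assume "\<exists>s\<in>S. s * a \<in> J"
  then obtain s where s: "s \<in> S" "s * a \<in> J" by blast
  show "frac a 1 \<in> Idl\<^bsub>L\<^esub> ((\<lambda>j. frac j 1) ` J)"
  proof (unfold genideal_def, clarify)
    fix K assume K: "ideal K L" "(\<lambda>j. frac j 1) ` J \<subseteq> K"
    have "frac 1 s \<otimes>\<^bsub>L\<^esub> frac (s * a) 1 \<in> K"
      using K s by (intro ideal.I_l_closed) (auto simp: frac_simps)
    also have "frac 1 s \<otimes>\<^bsub>L\<^esub> frac (s * a) 1 = frac a 1"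
      using s assms by (auto simp: frac_simps intro!: frac_cong del: equalityI)
    finally show "frac a 1 \<in> K" .
  qed
qed

end

section \<open>Contractions, associated primes and symbolic powers expressed inside the ring\<close>

context type_cring
begin

lemma local_contraction_iff:
  assumes "primeideal p R" "ideal J R"
  shows "a \<in> local_contraction R p J \<longleftrightarrow> a \<in> carrier R \<and> (\<exists>s\<in>carrier R - p. s * a \<in> J)"
proof -
  interpret p: primeideal p R by fact
  interpret multiplicative_subset R "carrier R - p"
  proof
    show "1 \<in> carrier R - p"
      using p.one_imp_carrier p.I_notcarr type_closed by auto
    show "s * t \<in> carrier R - p" if "s \<in> carrier R - p" "t \<in> carrier R - p" for s t
      using p.I_prime[of s t] that type_closed by auto
  qed auto
  show ?thesis
    using frac_in_extension_iff[OF assms(2)]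
    by (auto simp: local_contraction_def local_extension_def)
qed

text \<open>Every element of the quotient is a coset \<open>I +> g\<close>, and \<open>r\<close>
  kills it exactly when \<open>r * g\<close> lies in \<open>I\<close>. So the associated primes are
  the prime ideals among the colon ideals \<open>I : g\<close>.\<close>

lemma associated_primes_iff:
  assumes "ideal I R"
  shows "p \<in> associated_primes R I \<longleftrightarrow>
    primeideal p R \<and> (\<exists>g\<in>carrier R. p = {r \<in> carrier R. r * g \<in> I})"
proof -
  interpret I: ideal I R by fact
  have "I +> r = I \<longleftrightarrow> r \<in> I" if "r \<in> carrier R" for r
    using I.a_rcos_self[OF that] a_rcos_zero[OF assms] by auto
  then have eq: "(I +> r) \<otimes>\<^bsub>R Quot I\<^esub> (I +> g) = \<zero>\<^bsub>R Quot I\<^esub> \<longleftrightarrow> r * g \<in> I"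
    if "r \<in> carrier R" "g \<in> carrier R" for r g
    using I.rcoset_mult_add[OF that] that by (simp add: FactRing_def type_closed)
  have "carrier (R Quot I) = (\<lambda>g. I +> g) ` carrier R"
    by (auto simp: FactRing_def A_RCOSETS_def' a_r_coset_def')
  then show ?thesis
    by (auto simp: associated_primes_def eq cong: conj_cong)
qed

lemma symbolic_power_iff:
  assumes "ideal I R" "ideal (ideal_power R I n) R"
  shows "a \<in> symbolic_power R I n \<longleftrightarrow> a \<in> carrier R \<and>
    (\<forall>p\<in>associated_primes R I. \<exists>s\<in>carrier R - p. s * a \<in> ideal_power R I n)"
  proof -
  have "primeideal p R" if "p \<in> associated_primes R I" for p
    using that associated_primes_iff[OF assms(1)] by blast
  then show ?thesis
    unfolding symbolic_power_def using local_contraction_iff[OF _ assms(2)] by blast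
qed

end


section \<open>Monomial ideals\<close>

abbreviation "keys \<equiv> Poly_Mapping.keys"
abbreviation "lookup \<equiv> Poly_Mapping.lookup"
abbreviation "single \<equiv> Poly_Mapping.single"

abbreviation mono_dvd :: "('v \<Rightarrow>\<^sub>0 nat) \<Rightarrow> ('v \<Rightarrow>\<^sub>0 nat) \<Rightarrow> bool" (infix "\<preceq>" 50) where
  "g \<preceq> m \<equiv> \<forall>x. lookup g x \<le> lookup m x"

lemma mono_dvd_diff: "g \<preceq> m \<Longrightarrow> m = g + (m - g)"
  by (rule poly_mapping_eqI) (simp add: lookup_add lookup_minus)

lemma keys_multE:
  fixes p :: "('v \<Rightarrow>\<^sub>0 nat) \<Rightarrow>\<^sub>0 'k::semiring_0"
  assumes "m \<in> keys (p * q)"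
  obtains a b where "a \<in> keys p" "b \<in> keys q" "m = a + b"
  using assms keys_mult[of p q] by blast

lemma keys_plus_nat: "keys (a + b) = keys a \<union> keys (b :: 'v \<Rightarrow>\<^sub>0 nat)"
  by (auto simp: in_keys_iff lookup_add)

lemma mpoly_ring_simps [simp]:
  "mult (mpoly_ring V) = (*)" "one (mpoly_ring V) = 1"
  "zero (mpoly_ring V) = 0" "add (mpoly_ring V) = (+)"
  by (simp_all add: mpoly_ring_def)

lemma carrier_mpoly_ring: "p \<in> carrier (mpoly_ring V) \<longleftrightarrow> (\<forall>m\<in>keys p. keys m \<subseteq> V)"
  by (simp add: mpoly_ring_def)

interpretation mpoly: type_cring "mpoly_ring V" for V :: "'v set"
proof (intro type_cring.intro cringI abelian_groupI comm_monoidI type_cring_axioms.intro)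
  fix x y :: "('v \<Rightarrow>\<^sub>0 nat) \<Rightarrow>\<^sub>0 'k::field"
  assume x: "x \<in> carrier (mpoly_ring V)"
  then have "- x \<in> carrier (mpoly_ring V)"
    by (auto simp: carrier_mpoly_ring in_keys_iff)
  then show "\<exists>y\<in>carrier (mpoly_ring V). y \<oplus>\<^bsub>mpoly_ring V\<^esub> x = \<zero>\<^bsub>mpoly_ring V\<^esub>"
    by (auto intro!: bexI[of _ "- x"])
  assume y: "y \<in> carrier (mpoly_ring V)"
  show "x \<otimes>\<^bsub>mpoly_ring V\<^esub> y \<in> carrier (mpoly_ring V)"
    using x y by (fastforce simp: carrier_mpoly_ring keys_plus_nat elim!: keys_multE)
  show "x \<oplus>\<^bsub>mpoly_ring V\<^esub> y \<in> carrier (mpoly_ring V)"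
    using x y keys_add[of x y] unfolding mpoly_ring_simps carrier_mpoly_ring by blast
qed (auto simp: carrier_mpoly_ring algebra_simps)

text \<open>The generated ideal is encoded by a condition on each term separately, which turns
  comparisons of ideals into comparisons of sets of exponent vectors. \<open>Idl_monomials\<close>
  identifies it with the ideal generated by the monomials of \<open>G\<close> when these are
  supported in \<open>V\<close>.\<close>

definition monomial_ideal ::
    "'v set \<Rightarrow> ('v \<Rightarrow>\<^sub>0 nat) set \<Rightarrow> (('v \<Rightarrow>\<^sub>0 nat) \<Rightarrow>\<^sub>0 'k::field) set" where
  "monomial_ideal V G = {p. \<forall>m\<in>keys p. keys m \<subseteq> V \<and> (\<exists>g\<in>G. g \<preceq> m)}"

lemma ideal_monomial_ideal:
  "ideal (monomial_ideal V G :: (('v \<Rightarrow>\<^sub>0 nat) \<Rightarrow>\<^sub>0 'k::field) set) (mpoly_ring V)"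
proof (rule mpoly.type_idealI)
  fix x y r :: "('v \<Rightarrow>\<^sub>0 nat) \<Rightarrow>\<^sub>0 'k"
  show "x + y \<in> monomial_ideal V G" if "x \<in> monomial_ideal V G" "y \<in> monomial_ideal V G"
    using that keys_add[of x y] unfolding monomial_ideal_def by blast
  show "r * x \<in> monomial_ideal V G" if "x \<in> monomial_ideal V G" "r \<in> carrier (mpoly_ring V)"
  proof -
    have "keys m \<subseteq> V \<and> (\<exists>g\<in>G. g \<preceq> m)" if m: "m \<in> keys (r * x)" for m
    proof -
      from m obtain a b where ab: "a \<in> keys r" "b \<in> keys x" "m = a + b"
        by (rule keys_multE)
      then obtain g where "keys a \<subseteq> V" "keys b \<subseteq> V" "g \<in> G" "g \<preceq> b"
        using \<open>x \<in> _\<close> \<open>r \<in> _\<close> by (auto simp: monomial_ideal_def carrier_mpoly_ring)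
      with ab show ?thesis
        by (auto simp: keys_plus_nat lookup_add trans_le_add2 intro!: bexI[of _ g])
    qed
    then show ?thesis by (auto simp: monomial_ideal_def)
  qed
qed (auto simp: monomial_ideal_def carrier_mpoly_ring)

lemma poly_eq_sum_monomials: "p = (\<Sum>m\<in>keys p. single m (lookup p m))"
  by (rule poly_mapping_eqI) (auto simp: lookup_sum lookup_single when_def in_keys_iff)

lemma monomials_in_ideal:
  fixes p :: "('v \<Rightarrow>\<^sub>0 nat) \<Rightarrow>\<^sub>0 'k::field"
  assumes "ideal K (mpoly_ring V)" "\<And>m. m \<in> keys p \<Longrightarrow> single m (lookup p m) \<in> K"
  shows "p \<in> K"
proof -
  interpret K: ideal K "mpoly_ring V" by fact
  have "(\<Sum>m\<in>M. single m (lookup p m)) \<in> K" if "finite M" "M \<subseteq> keys p" for M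
    using that
  proof (induction rule: finite_induct)
    case empty
    then show ?case using K.zero_closed by simp
  next
    case (insert m M)
    then show ?case
      using K.a_closed[of "single m (lookup p m)"] assms(2) by simp
  qed
  from this[of "keys p"] show ?thesis
    by (simp flip: poly_eq_sum_monomials)
qed

text \<open>Each term of an element is a multiple of some generator, and \<open>K\<close> contains
  the sum of the terms. A generator involving a variable outside \<open>V\<close> divides no
  monomial of \<open>k[V]\<close>, whence the restriction on \<open>g\<close>.\<close>

lemma monomial_ideal_subset:
  fixes K :: "(('v \<Rightarrow>\<^sub>0 nat) \<Rightarrow>\<^sub>0 'k::field) set"
  assumes "ideal K (mpoly_ring V)" "\<And>g. g \<in> G \<Longrightarrow> keys g \<subseteq> V \<Longrightarrow> single g 1 \<in> K"
  shows "monomial_ideal V G \<subseteq> K"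
proof
  interpret K: ideal K "mpoly_ring V" by fact
  fix p :: "('v \<Rightarrow>\<^sub>0 nat) \<Rightarrow>\<^sub>0 'k" assume p: "p \<in> monomial_ideal V G"
  show "p \<in> K"
  proof (rule monomials_in_ideal[OF assms(1)])
    fix m assume m: "m \<in> keys p"
    then obtain g where g: "keys m \<subseteq> V" "g \<in> G" "g \<preceq> m"
      using p by (auto simp: monomial_ideal_def)
    have eq: "m = g + (m - g)"
      using g mono_dvd_diff by blast
    then have sub: "keys g \<subseteq> V" "keys (m - g) \<subseteq> V"
      using g(1) keys_plus_nat[of g "m - g"] by auto
    have "single (m - g) (lookup p m) * single g 1 \<in> K"
      using K.I_l_closed[of "single g 1" "single (m - g) (lookup p m)"] assms(2) g(2) sub
      by (auto simp: carrier_mpoly_ring split: if_splits)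
    also have "single (m - g) (lookup p m) * single g 1 = single m (lookup p m)"
      using eq by (simp add: mult_single add.commute)
    finally show "single m (lookup p m) \<in> K" .
  qed
qed

lemma monomial_in_monomial_ideal_iff [simp]:
  "single m 1 \<in> monomial_ideal V G \<longleftrightarrow> keys m \<subseteq> V \<and> (\<exists>g\<in>G. g \<preceq> m)"
  by (simp add: monomial_ideal_def)

lemma Idl_monomials:
  assumes "\<And>g. g \<in> G \<Longrightarrow> keys g \<subseteq> V"
  shows "Idl\<^bsub>mpoly_ring V\<^esub> ((\<lambda>g. single g 1) ` G) = monomial_ideal V G"
proof (rule equalityI)
  show "Idl\<^bsub>mpoly_ring V\<^esub> ((\<lambda>g. single g 1) ` G) \<subseteq> monomial_ideal V G"
    using assms by (intro mpoly.genideal_minimal ideal_monomial_ideal) auto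
  have sub: "(\<lambda>g. single g 1) ` G \<subseteq> carrier (mpoly_ring V)"
    using assms by (auto simp: carrier_mpoly_ring)
  show "monomial_ideal V G \<subseteq> Idl\<^bsub>mpoly_ring V\<^esub> ((\<lambda>g. single g 1) ` G)"
    using mpoly.genideal_self[OF sub]
    by (intro monomial_ideal_subset mpoly.genideal_ideal sub) auto
qed

lemma ideal_prod_monomial_ideal:
  assumes "\<And>g. g \<in> G \<Longrightarrow> keys g \<subseteq> V" "\<And>g. g \<in> G' \<Longrightarrow> keys g \<subseteq> V"
  shows "ideal_prod (mpoly_ring V) (monomial_ideal V G) (monomial_ideal V G') =
    monomial_ideal V {g + g' | g g'. g \<in> G \<and> g' \<in> G'}" (is "?P = monomial_ideal V ?GG")
proof (rule equalityI)
  show "?P \<subseteq> monomial_ideal V ?GG"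
  proof
    fix x assume "x \<in> ?P"
    then show "x \<in> monomial_ideal V ?GG"
    proof (induction rule: ideal_prod.induct)
      case (prod i j)
      have "keys m \<subseteq> V \<and> (\<exists>g\<in>?GG. g \<preceq> m)" if m: "m \<in> keys (i * j)" for m
      proof -
        from m obtain a b where ab: "a \<in> keys i" "b \<in> keys j" "m = a + b"
          by (rule keys_multE)
        with prod obtain g g' where g: "g \<in> G" "g' \<in> G'" "g \<preceq> a" "g' \<preceq> b"
          and V: "keys a \<subseteq> V" "keys b \<subseteq> V"
          unfolding monomial_ideal_def by blast
        have "g + g' \<preceq> m"
          using g ab by (simp add: lookup_add add_mono)
        with g V ab show ?thesis
          by (simp add: keys_plus_nat) blast
      qed
      then show ?case
        by (simp add: monomial_ideal_def)
    next
      case (sum s t)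
      then show ?case
        using additive_subgroup.a_closed[OF ideal.axioms(1)[OF ideal_monomial_ideal[of V ?GG]]]
        by simp
    qed
  qed
  have "single g 1 * single g' 1 \<in> ?P" if "g \<in> G" "g' \<in> G'" for g g'
    using ideal_prod.prod[of "single g 1" "monomial_ideal V G" "single g' 1" "monomial_ideal V G'"
        "mpoly_ring V"] that assms by auto
  then show "monomial_ideal V ?GG \<subseteq> ?P"
    by (intro monomial_ideal_subset mpoly.ideal_prod_is_ideal ideal_monomial_ideal)
      (auto simp: mult_single)
qed

lemma set_add_monomial_ideal:
  "monomial_ideal V G <+>\<^bsub>mpoly_ring V\<^esub> monomial_ideal V G' = monomial_ideal V (G \<union> G')"
  (is "?S = _")
proof (rule equalityI)
  have "monomial_ideal V G \<subseteq> monomial_ideal V (G \<union> G')"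
       "monomial_ideal V G' \<subseteq> monomial_ideal V (G \<union> G')"
    unfolding monomial_ideal_def by blast+
  then show "?S \<subseteq> monomial_ideal V (G \<union> G')"
    using additive_subgroup.a_closed[OF ideal.axioms(1)[OF ideal_monomial_ideal[of V "G \<union> G'"]]]
    by (auto simp: set_add_def')
  have *: "x \<in> ?S" if "x \<in> monomial_ideal V G \<or> x \<in> monomial_ideal V G'" for x
  proof -
    have "0 \<in> monomial_ideal V G" "0 \<in> monomial_ideal V G'"
      by (simp_all add: monomial_ideal_def)
    with that show ?thesis
      unfolding set_add_def' by (metis (mono_tags, lifting) UN_iff add.left_neutral
          add.right_neutral insertI1 mpoly_ring_simps(4))
  qed
  then show "monomial_ideal V (G \<union> G') \<subseteq> ?S"
    by (intro monomial_ideal_subset mpoly.add_ideals ideal_monomial_ideal) (rule *, auto)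
qed

text \<open>The product of finite sets of monomials has an element with a unique factorization; this
  replaces a monomial order, since \<open>'v\<close> carries none.\<close>

lemma unique_product:
  fixes A B :: "('v \<Rightarrow>\<^sub>0 nat) set"
  assumes "finite A" "A \<noteq> {}" "finite B" "B \<noteq> {}"
  shows "\<exists>a\<in>A. \<exists>b\<in>B. \<forall>a'\<in>A. \<forall>b'\<in>B. a' + b' = a + b \<longrightarrow> a' = a \<and> b' = b"
proof -
  \<comment> \<open>The claim is generalised for induction on a set \<open>X\<close> of variables
    outside of which the members of each of the two sets agree. For empty \<open>X\<close> both sets
    are singletons.\<close>
  have main: "\<exists>a\<in>A. \<exists>b\<in>B. \<forall>a'\<in>A. \<forall>b'\<in>B. a' + b' = a + b \<longrightarrow> a' = a \<and> b' = b"
    if "finite X" "finite A" "A \<noteq> {}" "finite B" "B \<noteq> {}"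
      "\<And>a a' x. a \<in> A \<Longrightarrow> a' \<in> A \<Longrightarrow> x \<notin> X \<Longrightarrow> lookup a x = lookup a' x"
      "\<And>b b' x. b \<in> B \<Longrightarrow> b' \<in> B \<Longrightarrow> x \<notin> X \<Longrightarrow> lookup b x = lookup b' x"
    for X :: "'v set" and A B :: "('v \<Rightarrow>\<^sub>0 nat) set"
    using that
  proof (induction X arbitrary: A B rule: finite_induct)
    case empty
    have "a = a'" if "a \<in> A" "a' \<in> A" for a a'
      using empty(5)[OF that] by (intro poly_mapping_eqI) simp
    moreover have "b = b'" if "b \<in> B" "b' \<in> B" for b b'
      using empty(6)[OF that] by (intro poly_mapping_eqI) simp
    moreover obtain a b where "a \<in> A" "b \<in> B"
      using empty(2,4) by blast
    ultimately show ?case by metis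
  next
    case (insert x X)
    \<comment> \<open>Only the members with maximal exponent at \<open>x\<close> are kept. A sum
      with exponent \<open>M + N\<close> at \<open>x\<close> can arise from these alone, and they
      agree at \<open>x\<close>, so the induction hypothesis for \<open>X\<close> applies to
      them.\<close>
    define M where "M = Max ((\<lambda>a. lookup a x) ` A)"
    define N where "N = Max ((\<lambda>b. lookup b x) ` B)"
    have "M \<in> (\<lambda>a. lookup a x) ` A" "N \<in> (\<lambda>b. lookup b x) ` B"
      unfolding M_def N_def using insert.prems(1-4) by (auto intro!: Max_in simp del: Max_eq_iff)
    then have ex: "\<exists>a\<in>A. lookup a x = M" "\<exists>b\<in>B. lookup b x = N"
      by auto
    have M: "\<And>a. a \<in> A \<Longrightarrow> lookup a x \<le> M"
      using insert.prems(1) by (simp add: M_def)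
    have N: "\<And>b. b \<in> B \<Longrightarrow> lookup b x \<le> N"
      using insert.prems(3) by (simp add: N_def)
    define A' where "A' = {a\<in>A. lookup a x = M}"
    define B' where "B' = {b\<in>B. lookup b x = N}"
    have "\<exists>a\<in>A'. \<exists>b\<in>B'. \<forall>a'\<in>A'. \<forall>b'\<in>B'. a' + b' = a + b \<longrightarrow> a' = a \<and> b' = b"
    proof (rule insert.IH)
      show "lookup a y = lookup a' y" if "a \<in> A'" "a' \<in> A'" "y \<notin> X" for a a' y
        using that insert.prems(5)[of a a' y] by (cases "y = x") (auto simp: A'_def)
      show "lookup b y = lookup b' y" if "b \<in> B'" "b' \<in> B'" "y \<notin> X" for b b' y
        using that insert.prems(6)[of b b' y] by (cases "y = x") (auto simp: B'_def)
    qed (use insert.prems(1,3) ex in \<open>auto simp: A'_def B'_def\<close>)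
    then obtain a b where ab: "a \<in> A'" "b \<in> B'"
      "\<And>a' b'. a' \<in> A' \<Longrightarrow> b' \<in> B' \<Longrightarrow> a' + b' = a + b \<Longrightarrow> a' = a \<and> b' = b"
      by blast
    have "a' = a \<and> b' = b" if "a' \<in> A" "b' \<in> B" "a' + b' = a + b" for a' b'
    proof (rule ab(3))
      have "lookup (a' + b') x = M + N"
        using that ab by (auto simp: A'_def B'_def lookup_add)
      then have "lookup a' x = M" "lookup b' x = N"
        using M[OF that(1)] N[OF that(2)] by (simp_all add: lookup_add)
      then show "a' \<in> A'" "b' \<in> B'"
        using that by (auto simp: A'_def B'_def)
    qed (fact that(3))
    then show ?case
      using ab(1,2) unfolding A'_def B'_def by blast
  qed
  show ?thesis
  proof (rule main[of "\<Union>m\<in>A \<union> B. keys m"])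
    show "finite (\<Union>m\<in>A \<union> B. keys m)"
      using assms by auto
  qed (use assms in \<open>auto simp: in_keys_iff\<close>)
qed

text \<open>Every other pair in the convolution has a zero coefficient. The vectors \<open>a\<close>
  and \<open>b\<close> may lie outside the supports, in which case both sides are 0;
  \<open>keys_mult_monomial\<close> relies on this.\<close>

lemma lookup_mult_unique:
  fixes p q :: "('v \<Rightarrow>\<^sub>0 nat) \<Rightarrow>\<^sub>0 'k::semiring_0"
  assumes "\<And>a' b'. a' \<in> keys p \<Longrightarrow> b' \<in> keys q \<Longrightarrow> a' + b' = a + b \<Longrightarrow> a' = a \<and> b' = b"
  shows "lookup (p * q) (a + b) = lookup p a * lookup q b"
proof -
  have "lookup (p * q) (a + b) =
      (\<Sum>(a', b'). lookup p a' * lookup q b' when a + b = a' + b')"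
    by (simp add: times_poly_mapping.rep_eq prod_fun_unfold_prod)
  also have "\<dots> = (\<Sum>ab. lookup p a * lookup q b when ab = (a, b))"
  proof (rule Sum_any.cong, clarify)
    fix a' b'
    have "lookup p a' * lookup q b' = 0" if "a + b = a' + b'" "(a', b') \<noteq> (a, b)"
      using assms[of a' b'] that by (metis in_keys_iff mult_zero_left mult_zero_right)
    then show "(lookup p a' * lookup q b' when a + b = a' + b') =
        (lookup p a * lookup q b when (a', b') = (a, b))"
      by (auto simp: when_def)
  qed
  finally show ?thesis by simp
qed

text \<open>Let \<open>D\<close> be the least degree in \<open>a\<close>. Only terms of degree 0 in
  \<open>s\<close> and of degree \<open>D\<close> in \<open>a\<close> contribute to degree
  \<open>D\<close> of the product, and by \<open>unique_product\<close> one of the resulting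
  monomials survives. With \<open>d\<close> the degree in the variables of a cover, this gives both
  the primality of the ideal of those variables and the cancellation of denominators outside
  it.\<close>

lemma order_of_product:
  fixes s a :: "('v \<Rightarrow>\<^sub>0 nat) \<Rightarrow>\<^sub>0 'k::semiring_no_zero_divisors"
    and d :: "('v \<Rightarrow>\<^sub>0 nat) \<Rightarrow> nat"
  assumes d_add: "\<And>m m'. d (m + m') = d m + d m'"
    and "\<exists>m\<in>keys s. d m = 0" and "\<And>m. m \<in> keys (s * a) \<Longrightarrow> n \<le> d m" and "m \<in> keys a"
  shows "n \<le> d m"
proof -
  define D where "D = Min (d ` keys a)"
  have "D \<in> d ` keys a"
    unfolding D_def using assms(4) by (intro Min_in) auto
  then have D: "\<And>m. m \<in> keys a \<Longrightarrow> D \<le> d m" "\<exists>m\<in>keys a. d m = D"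
    by (auto simp: D_def)
  let ?A = "{u\<in>keys s. d u = 0}" and ?B = "{v\<in>keys a. d v = D}"
  have "finite ?A" "?A \<noteq> {}" "finite ?B" "?B \<noteq> {}"
    using D(2) assms(2) by auto
  from unique_product[OF this] obtain u v where "u \<in> ?A" "v \<in> ?B"
    and uniq: "\<forall>u'\<in>?A. \<forall>v'\<in>?B. u' + v' = u + v \<longrightarrow> u' = u \<and> v' = v"
    by (elim bexE)
  then have uv: "u \<in> keys s" "d u = 0" "v \<in> keys a" "d v = D"
    by auto
  have "u' = u \<and> v' = v" if "u' \<in> keys s" "v' \<in> keys a" "u' + v' = u + v" for u' v'
  proof (rule uniq[rule_format])
    have "d u' + d v' = D"
      using d_add[of u' v'] d_add[of u v] uv that(3) by simp
    then have "d u' = 0" "d v' = D"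
      using D(1)[OF that(2)] by auto
    then show "u' \<in> ?A" "v' \<in> ?B"
      using that by auto
  qed (fact that(3))
  then have "lookup (s * a) (u + v) = lookup s u * lookup a v"
    by (rule lookup_mult_unique)
  then have "u + v \<in> keys (s * a)"
    using uv by (simp add: in_keys_iff)
  then have "n \<le> D"
    using assms(3)[of "u + v"] uv by (simp add: d_add)
  then show ?thesis
    using D(1)[OF assms(4)] by simp
qed


section \<open>Tripartite hypergraphs\<close>

definition squarefree_monomial :: "'v set \<Rightarrow> 'v \<Rightarrow>\<^sub>0 nat" where
  "squarefree_monomial E = (\<Sum>x\<in>E. single x 1)"

lemma lookup_squarefree_monomial:
  "finite E \<Longrightarrow> lookup (squarefree_monomial E) x = of_bool (x \<in> E)"
  by (auto simp: squarefree_monomial_def lookup_sum lookup_single when_def)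

lemma keys_squarefree_monomial: "finite E \<Longrightarrow> keys (squarefree_monomial E) = E"
  by (auto simp: in_keys_iff lookup_squarefree_monomial)

lemma prod_mpoly_var:
  "finite E \<Longrightarrow> (\<Prod>x\<in>E. mpoly_var x) = single (squarefree_monomial E) 1"
  by (induction rule: finite_induct) (auto simp: squarefree_monomial_def mpoly_var_def mult_single)

text \<open>\<open>e i\<close> is the vertex of the edge \<open>e\<close> in part \<open>i\<close>, and \<open>W\<close> is the set of vertices of weight 1.\<close>

lemma transversal_family_triangle:
  fixes T :: "(nat \<Rightarrow> 'v) set"
  assumes "T \<noteq> {}"
    and meet: "\<And>e f. e \<in> T \<Longrightarrow> f \<in> T \<Longrightarrow> \<exists>i<3. e i = f i \<and> e i \<in> W"
    and miss: "\<And>e i. e \<in> T \<Longrightarrow> i < 3 \<Longrightarrow> e i \<in> W \<Longrightarrow> \<exists>g\<in>T. g i \<noteq> e i"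
  obtains e f g i j k where "e \<in> T" "f \<in> T" "g \<in> T" "i < 3" "j < 3" "k < 3"
    "i \<noteq> j" "i \<noteq> k" "j \<noteq> k" "e i = f i" "e j \<noteq> f j" "e k \<noteq> f k"
    "g i \<noteq> e i" "g j = e j" "g k = f k"
proof -
  have triple: "n = i \<or> n = j \<or> n = k"
    if "i < 3" "j < 3" "k < 3" "i \<noteq> j" "i \<noteq> k" "j \<noteq> k" "n < 3" for i j k n :: nat
    using that by linarith
  have others: "\<exists>j k. j < 3 \<and> k < 3 \<and> i \<noteq> j \<and> i \<noteq> k \<and> j \<noteq> k" for i :: nat
    by (rule exI[of _ "if i = 0 then 1 else 0"], rule exI[of _ "if i = 2 then 1 else 2"]) auto
  let ?A = "\<lambda>e f i. e i = f i \<and> e i \<in> W"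
  \<comment> \<open>Otherwise any two members agree, with weight 1, in at least two of the three
    parts; in particular, if they do not do so in one part, they do in both others.\<close>
  have "\<exists>e\<in>T. \<exists>f\<in>T. \<exists>i<3. \<forall>n<3. ?A e f n \<longleftrightarrow> n = i"
  proof (rule ccontr)
    assume neg: "\<not> ?thesis"
    have two: "?A e f j \<and> ?A e f k"
      if ef: "e \<in> T" "f \<in> T" "\<not> ?A e f i" and ijk: "i < 3" "j < 3" "k < 3" "i \<noteq> j" "i \<noteq> k" "j \<noteq> k"
      for e f i j k
    proof -
      obtain l where l: "l < 3" "?A e f l"
        using meet[OF ef(1,2)] by blast
      have "\<not> (\<forall>n<3. ?A e f n \<longleftrightarrow> n = l)"
        using neg ef(1,2) l(1) by blast
      with l obtain n where n: "n < 3" "?A e f n" "n \<noteq> l"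
        by blast
      show ?thesis
        using triple[OF ijk l(1)] triple[OF ijk n(1)] l n ef(3) by auto
    qed
    obtain e where e: "e \<in> T" using \<open>T \<noteq> {}\<close> by blast
    \<comment> \<open>Here \<open>meet\<close> is applied to \<open>e\<close> and itself.\<close>
    then obtain i where i: "i < 3" "e i \<in> W" using meet by blast
    then obtain f where f: "f \<in> T" "f i \<noteq> e i" using miss e by blast
    obtain j k where jk: "j < 3" "k < 3" "i \<noteq> j" "i \<noteq> k" "j \<noteq> k" using others by blast
    have ef: "?A e f j" "?A e f k"
      using two[of e f i j k] e f i jk by auto
    \<comment> \<open>\<open>e\<close> and \<open>f\<close> differ in part \<open>i\<close> and
      coincide in part \<open>j\<close>. A \<open>g\<close> leaving both of them in part
      \<open>j\<close> must agree with both in part \<open>i\<close>, which forces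
      \<open>e i = f i\<close>.\<close>
    obtain g where g: "g \<in> T" "g j \<noteq> e j"
      using miss[of e j] e ef jk by blast
    have "e i = g i" "f i = g i"
      using two[of e g j i k] two[of f g j i k] e f g i jk ef by auto
    with f show False by simp
  qed
  then obtain e f i where e: "e \<in> T" and f: "f \<in> T" and i: "i < 3"
    and ef: "\<And>n. n < 3 \<Longrightarrow> ?A e f n \<longleftrightarrow> n = i"
    by blast
  obtain j k where jk: "j < 3" "k < 3" "i \<noteq> j" "i \<noteq> k" "j \<noteq> k" using others by blast
  obtain g where g: "g \<in> T" "g i \<noteq> e i"
    using miss[of e i] e i ef by blast
  have ei: "e i = f i" and nj: "\<not> ?A e f j" and nk: "\<not> ?A e f k"
    using ef i jk by auto
  obtain n n' where n: "n < 3" "?A e g n" "n' < 3" "?A f g n'"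
    using meet[OF e g(1)] meet[OF f g(1)] by blast
  have "?A e g j \<or> ?A e g k" "?A f g j \<or> ?A f g k"
    using triple[OF i jk n(1)] triple[OF i jk n(3)] n g ei by auto
  \<comment> \<open>\<open>g\<close> cannot meet \<open>e\<close> and \<open>f\<close> in the same
    part, since they would then share a weight 1 vertex there. As the vertices where
    \<open>g\<close> meets them have weight 1, \<open>nj\<close> and \<open>nk\<close> yield the
    genuine inequalities \<open>e j \<noteq> f j\<close> and \<open>e k \<noteq> f k\<close>. The
    second case is the first with \<open>j\<close> and \<open>k\<close> exchanged.\<close>
  then consider "?A e g j" "?A f g k" | "?A e g k" "?A f g j"
    using nj nk by auto
  then show ?thesis
  proof cases
    case 1
    then show ?thesis
      using e f g i jk ei nj nk by (intro that[of e f g i j k]) auto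
  next
    case 2
    then show ?thesis
      using e f g i jk ei nj nk by (intro that[of e f g i k j]) auto
  qed
qed

section \<open>Bad triangles and vertex covers\<close>

lemma bad3_subhypergraphI:
  assumes "{a, b, c} \<in> H" "{a, b', c'} \<in> H" "{a', b, c'} \<in> H" "distinct [a, b, c, a', b', c']"
  shows "bad3_subhypergraph H {{a, b, c}, {a, b', c'}, {a', b, c'}}"
proof -
  let ?B = "{{a, b, c}, {a, b', c'}, {a', b, c'}}"
  \<comment> \<open>The vertices \<open>a\<close>, \<open>b\<close>, \<open>c'\<close> lie on two
    edges each and go to 3, 2, 5; the vertices \<open>c\<close>, \<open>b'\<close>,
    \<open>a'\<close> lie on one edge each and go to 1, 4, 6.\<close>
  define f where "f v = (if v = c then 1 else if v = b then 2 else if v = a then 3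
    else if v = b' then 4 else if v = c' then 5 else 6 :: nat)" for v
  have f: "f c = 1" "f b = 2" "f a = 3" "f b' = 4" "f c' = 5" "f a' = 6"
    using assms(4) by (auto simp: f_def)
  have "bij_betw f (\<Union>?B) bad3_vertices"
    by (auto simp: bij_betw_def inj_on_def f bad3_vertices_def)
  moreover have "(\<lambda>E. f ` E) ` ?B = bad3_edges"
    by (simp add: f bad3_edges_def insert_commute)
  ultimately show ?thesis
    unfolding bad3_subhypergraph_def hypergraph_isomorphic_def using assms(1-3) by blast
qed

lemma bad3_subhypergraph_subset: "bad3_subhypergraph H B \<Longrightarrow> B \<subseteq> H"
  by (auto simp: bad3_subhypergraph_def)

lemma bad3_no_common_vertex:
  assumes "bad3_subhypergraph H B"
  shows "\<exists>E\<in>B. x \<notin> E"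
proof (rule ccontr)
  assume "\<not> ?thesis"
  then have x: "\<forall>E\<in>B. x \<in> E" by blast
  obtain f where "(\<lambda>E. f ` E) ` B = bad3_edges"
    using assms by (auto simp: bad3_subhypergraph_def hypergraph_isomorphic_def)
  with x have "\<forall>K\<in>bad3_edges. f x \<in> K" by blast
  then show False by (auto simp: bad3_edges_def)
qed

text \<open>A vertex of \<open>C\<close> on one edge of \<open>B\<close> misses some other edge of
  \<open>B\<close>, which needs a second vertex of \<open>C\<close>. This is what places the bad
  monomials in the symbolic square.\<close>

lemma cover_bad3:
  assumes "vertex_cover V H C" "bad3_subhypergraph H B" "finite C"
  shows "2 \<le> card (C \<inter> \<Union>B)"
proof -
  have meets: "\<And>E. E \<in> B \<Longrightarrow> C \<inter> E \<noteq> {}"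
    using assms(1) bad3_subhypergraph_subset[OF assms(2)] by (auto simp: vertex_cover_def)
  obtain E where "E \<in> B"
    using bad3_no_common_vertex[OF assms(2)] by blast
  with meets obtain x where x: "x \<in> C" "x \<in> E" by blast
  obtain E' where "E' \<in> B" "x \<notin> E'"
    using bad3_no_common_vertex[OF assms(2)] by blast
  with meets obtain y where y: "y \<in> C" "y \<in> E'" by blast
  have "card {x, y} \<le> card (C \<inter> \<Union>B)"
    using assms(3) x y \<open>E \<in> B\<close> \<open>E' \<in> B\<close> by (intro card_mono) auto
  moreover have "x \<noteq> y"
    using y \<open>x \<notin> E'\<close> by blast
  ultimately show ?thesis by simp
qed

text \<open>The hard inclusion, at the level of exponents. The degree hypothesis is applied to
  covers consisting of the vertices of exponent 0 and at most one further vertex.\<close>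

lemma degree_two_divides:
  fixes m :: "'v \<Rightarrow>\<^sub>0 nat"
  assumes "simple_hypergraph V H" "partite_hypergraph 3 V H"
    and deg: "\<And>C. vertex_cover V H C \<Longrightarrow> 2 \<le> (\<Sum>x\<in>C. lookup m x)"
  shows "(\<exists>e\<in>H. \<exists>f\<in>H. squarefree_monomial e + squarefree_monomial f \<preceq> m) \<or>
    (\<exists>B. bad3_subhypergraph H B \<and> squarefree_monomial (\<Union>B) \<preceq> m)"
proof (rule ccontr)
  assume neg: "\<not> ?thesis"
  have V: "finite V" and edge: "\<And>E. E \<in> H \<Longrightarrow> E \<subseteq> V" and fin: "\<And>E. E \<in> H \<Longrightarrow> finite E"
    using assms(1) by (auto simp: simple_hypergraph_def intro: finite_subset)
  obtain P :: "nat \<Rightarrow> 'v set" where P: "V = (\<Union>i<3. P i)" "disjoint_family_on P {..<3}"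
    "\<And>i E. i < 3 \<Longrightarrow> E \<in> H \<Longrightarrow> card (P i \<inter> E) = 1"
    using assms(2) by (auto simp: partite_hypergraph_def)
  \<comment> \<open>Edges become choice functions on the parts, the form in which
    \<open>transversal_family_triangle\<close> treats them.\<close>
  define pt where "pt E i = the_elem (P i \<inter> E)" for E i
  have pt: "P i \<inter> E = {pt E i}" if "i < 3" "E \<in> H" for i E
    using P(3)[OF that] by (metis card_1_singletonE pt_def the_elem_eq)
  have in_edge: "x \<in> E \<longleftrightarrow> pt E i = x" if "E \<in> H" "i < 3" "x \<in> P i" for E i x
    using pt[OF that(2,1)] that(3) by (metis IntE IntI insertCI singletonD)
  have pt_in: "pt E i \<in> P i" "pt E i \<in> E" if "i < 3" "E \<in> H" for i E
    using pt[OF that] by blast+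
  have pt_neq: "pt E i \<noteq> pt F j" if "i < 3" "j < 3" "i \<noteq> j" "E \<in> H" "F \<in> H" for E F i j
    using P(2) that pt_in(1)[of i E] pt_in(1)[of j F]
    unfolding disjoint_family_on_def by (metis IntI emptyE lessThan_iff)
  have edge_eq: "E = {pt E i, pt E j, pt E k}"
    if "E \<in> H" "i < 3" "j < 3" "k < 3" "i \<noteq> j" "i \<noteq> k" "j \<noteq> k" for E i j k
  proof -
    have "n = i \<or> n = j \<or> n = k" if "n < 3" for n
      using that \<open>i < 3\<close> \<open>j < 3\<close> \<open>k < 3\<close> \<open>i \<noteq> j\<close> \<open>i \<noteq> k\<close> \<open>j \<noteq> k\<close> by linarith
    moreover have "\<exists>n<3. pt E n = x" if "x \<in> E" for x
      using that edge[OF \<open>E \<in> H\<close>] P(1) in_edge[OF \<open>E \<in> H\<close>] by blast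
    ultimately show ?thesis
      using pt_in(2) that by blast
  qed
  define Q where "Q = {E\<in>H. \<forall>x\<in>E. 1 \<le> lookup m x}"
  define W where "W = {x. lookup m x = 1}"
  have meet: "\<exists>x\<in>e \<inter> f. x \<in> W" if "e \<in> Q" "f \<in> Q" for e f
  proof (rule ccontr)
    assume "\<not> ?thesis"
    \<comment> \<open>The exponent 2 occurs only on the intersection, where \<open>m\<close> has
      exponent at least 1 and, by assumption, not 1.\<close>
    then have "squarefree_monomial e + squarefree_monomial f \<preceq> m"
      using that fin by (force simp: lookup_add lookup_squarefree_monomial Q_def W_def of_bool_def)
    then show False using neg that unfolding Q_def by blast
  qed
  \<comment> \<open>An edge outside \<open>Q\<close> has a vertex of exponent 0, so \<open>X\<close>
    has to meet only the edges in \<open>Q\<close>. Taking \<open>X\<close> empty, or a single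
    vertex of exponent 1, would give covers of degree 0 and 1.\<close>
  have cover: "vertex_cover V H ({y\<in>V. lookup m y = 0} \<union> X)" if "\<forall>g\<in>Q. X \<inter> g \<noteq> {}" "X \<subseteq> V" for X
  proof -
    have "({y\<in>V. lookup m y = 0} \<union> X) \<inter> E \<noteq> {}" if E: "E \<in> H" for E
    proof (cases "E \<in> Q")
      case False
      then obtain y where "y \<in> E" "lookup m y = 0" using E by (auto simp: Q_def)
      then show ?thesis using edge[OF E] by blast
    qed (use \<open>\<forall>g\<in>Q. X \<inter> g \<noteq> {}\<close> in blast)
    then show ?thesis using that(2) by (auto simp: vertex_cover_def)
  qed
  have Q_nonempty: "Q \<noteq> {}"
  proof
    assume "Q = {}"
    with deg[OF cover[of "{}"]] show False by simp
  qed
  have miss: "\<exists>g\<in>Q. x \<notin> g" if "x \<in> V" "x \<in> W" for x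
  proof (rule ccontr)
    assume "\<not> ?thesis"
    then have "2 \<le> (\<Sum>y\<in>{y\<in>V. lookup m y = 0} \<union> {x}. lookup m y)"
      using that by (intro deg cover) auto
    also have "\<dots> = 1"
      using that V by (simp add: W_def)
    finally show False by simp
  qed
  have "pt ` Q \<noteq> {}" using Q_nonempty by simp
  moreover have "\<exists>i<3. e i = f i \<and> e i \<in> W" if "e \<in> pt ` Q" "f \<in> pt ` Q" for e f
  proof -
    from that obtain E F where EF: "E \<in> Q" "F \<in> Q" "e = pt E" "f = pt F" by blast
    then have "E \<in> H" "F \<in> H" by (auto simp: Q_def)
    obtain x where x: "x \<in> E" "x \<in> F" "x \<in> W" using meet EF by blast
    then obtain i where "i < 3" "x \<in> P i" using edge \<open>E \<in> H\<close> P(1) by blast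
    then show ?thesis using in_edge x EF \<open>E \<in> H\<close> \<open>F \<in> H\<close> by metis
  qed
  moreover have "\<exists>g\<in>pt ` Q. g i \<noteq> e i" if e: "e \<in> pt ` Q" and i: "i < 3" "e i \<in> W" for e i
  proof -
    from e obtain E where E: "E \<in> Q" "E \<in> H" "e = pt E" by (auto simp: Q_def)
    then obtain g where "g \<in> Q" "e i \<notin> g"
      using miss[of "e i"] i pt_in(2)[of i E] edge by blast
    then show ?thesis
      using pt_in(2)[of i g] i(1) by (auto simp: Q_def)
  qed
  ultimately obtain e f g i j k where efg: "e \<in> pt ` Q" "f \<in> pt ` Q" "g \<in> pt ` Q"
    and ijk: "i < 3" "j < 3" "k < 3" "i \<noteq> j" "i \<noteq> k" "j \<noteq> k"
    and eqs: "e i = f i" "e j \<noteq> f j" "e k \<noteq> f k" "g i \<noteq> e i" "g j = e j" "g k = f k"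
    by (rule transversal_family_triangle)
  then obtain E F G where EFG: "E \<in> Q" "F \<in> Q" "G \<in> Q" "e = pt E" "f = pt F" "g = pt G"
    by blast
  then have H: "E \<in> H" "F \<in> H" "G \<in> H" by (auto simp: Q_def)
  let ?a = "e i" and ?b = "e j" and ?c = "e k" and ?a' = "g i" and ?b' = "f j" and ?c' = "f k"
  have sets: "E = {?a, ?b, ?c}" "F = {?a, ?b', ?c'}" "G = {?a', ?b, ?c'}"
    using edge_eq[OF H(1) ijk] edge_eq[OF H(2) ijk] edge_eq[OF H(3) ijk] EFG eqs by simp_all
  \<comment> \<open>Vertices in different parts differ by disjointness, and those in the same part
    by the three inequalities in \<open>eqs\<close>.\<close>
  have "distinct [?a, ?b, ?c, ?a', ?b', ?c']"
    using eqs pt_neq ijk H EFG by simp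
  then have "bad3_subhypergraph H {E, F, G}"
    unfolding sets using H[unfolded sets] by (intro bad3_subhypergraphI)
  moreover have "squarefree_monomial (\<Union>{E, F, G}) \<preceq> m"
    using EFG fin H by (auto simp: lookup_squarefree_monomial Q_def of_bool_def)
  ultimately show False using neg by blast
qed


section \<open>The symbolic square of an edge ideal\<close>

definition edge_monomials :: "'v set set \<Rightarrow> ('v \<Rightarrow>\<^sub>0 nat) set" where
  "edge_monomials H = squarefree_monomial ` H"

lemma sum_lookup_squarefree_monomial:
  assumes "finite C" "finite E"
  shows "(\<Sum>x\<in>C. lookup (squarefree_monomial E) x) = card (C \<inter> E)"
  using assms by (simp add: lookup_squarefree_monomial of_bool_def sum.If_cases Int_def)

lemma squarefree_monomial_dvd_iff:
  "finite E \<Longrightarrow> squarefree_monomial E \<preceq> m \<longleftrightarrow> (\<forall>x\<in>E. 1 \<le> lookup m x)"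
  by (auto simp: lookup_squarefree_monomial of_bool_def)

text \<open>Translation by \<open>u\<close> is injective on exponent vectors, so no terms
  cancel.\<close>

lemma keys_mult_monomial:
  fixes r :: "('v \<Rightarrow>\<^sub>0 nat) \<Rightarrow>\<^sub>0 'k::semiring_1"
  shows "keys (r * single u 1) = (\<lambda>n. n + u) ` keys r"
proof
  show "keys (r * single u 1) \<subseteq> (\<lambda>n. n + u) ` keys r"
    by (auto elim!: keys_multE split: if_splits)
  have "lookup (r * single u 1) (n + u) = lookup r n" for n
    by (subst lookup_mult_unique) (auto split: if_splits)
  then show "(\<lambda>n. n + u) ` keys r \<subseteq> keys (r * single u 1)"
    by (auto simp: in_keys_iff)
qed

section \<open>Edge ideals, their squares and the bad triangle ideal as monomial ideals\<close>

context
  fixes V :: "'v set" and H :: "'v set set"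
  assumes simple: "simple_hypergraph V H"
begin

lemma finite_V: "finite V"
  using simple by (simp add: simple_hypergraph_def)

lemma edge_subset: "E \<in> H \<Longrightarrow> E \<subseteq> V"
  using simple by (simp add: simple_hypergraph_def)

lemma finite_edge: "E \<in> H \<Longrightarrow> finite E"
  using edge_subset finite_V finite_subset by metis

lemma edge_monomials_keys: "g \<in> edge_monomials H \<Longrightarrow> keys g \<subseteq> V"
  using edge_subset finite_edge by (fastforce simp: edge_monomials_def keys_squarefree_monomial)

lemma edge_ideal_eq:
  "(edge_ideal V H :: (('v \<Rightarrow>\<^sub>0 nat) \<Rightarrow>\<^sub>0 'k::field) set) = monomial_ideal V (edge_monomials H)"
proof -
  have "{\<Prod>x\<in>E. mpoly_var x | E. E \<in> H} =
      (\<lambda>g. single g (1::'k)) ` edge_monomials H"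
    using finite_edge by (force simp: edge_monomials_def prod_mpoly_var)
  then show ?thesis
    using Idl_monomials[of "edge_monomials H" V] edge_monomials_keys by (simp add: edge_ideal_def)
qed

lemma edge_ideal_squared:
  "ideal_power (mpoly_ring V) (edge_ideal V H :: (('v \<Rightarrow>\<^sub>0 nat) \<Rightarrow>\<^sub>0 'k::field) set) 2 =
    monomial_ideal V {g + h | g h. g \<in> edge_monomials H \<and> h \<in> edge_monomials H}"
proof -
  \<comment> \<open>The power is built up from the unit of the monoid of ideals, the whole ring. It
    is the monomial ideal of the exponent vector 0, that is, of the monomial 1.\<close>
  have "carrier (mpoly_ring V) = (monomial_ideal V {0} :: (('v \<Rightarrow>\<^sub>0 nat) \<Rightarrow>\<^sub>0 'k) set)"
    by (simp add: mpoly_ring_def monomial_ideal_def)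
  then have "ideal_prod (mpoly_ring V) (carrier (mpoly_ring V)) (edge_ideal V H) =
      (edge_ideal V H :: (('v \<Rightarrow>\<^sub>0 nat) \<Rightarrow>\<^sub>0 'k) set)"
    using ideal_prod_monomial_ideal[of "{0}" V "edge_monomials H"] edge_monomials_keys
    by (simp add: edge_ideal_eq)
  then show ?thesis
    using ideal_prod_monomial_ideal[of "edge_monomials H" V "edge_monomials H"] edge_monomials_keys
    by (simp add: ideal_power_def ideals_set_def nat_pow_def numeral_2_eq_2 edge_ideal_eq)
qed

lemma bad3_ideal_eq:
  "Idl\<^bsub>mpoly_ring V\<^esub> {\<Prod>x\<in>\<Union>B. mpoly_var x | B. bad3_subhypergraph H B} =
    (monomial_ideal V (squarefree_monomial ` {\<Union>B | B. bad3_subhypergraph H B})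
      :: (('v \<Rightarrow>\<^sub>0 nat) \<Rightarrow>\<^sub>0 'k::field) set)"
proof -
  have sub: "\<Union>B \<subseteq> V" if "bad3_subhypergraph H B" for B
    using bad3_subhypergraph_subset[OF that] edge_subset by blast
  then have fin: "finite (\<Union>B)" if "bad3_subhypergraph H B" for B
    using finite_subset[OF _ finite_V] that by blast
  then have "{\<Prod>x\<in>\<Union>B. mpoly_var x | B. bad3_subhypergraph H B} =
      (\<lambda>g. single g (1::'k)) ` squarefree_monomial ` {\<Union>B | B. bad3_subhypergraph H B}"
    by (force simp: prod_mpoly_var)
  moreover have "keys g \<subseteq> V"
    if "g \<in> squarefree_monomial ` {\<Union>B | B. bad3_subhypergraph H B}" for g
  proof -
    from that obtain B where "bad3_subhypergraph H B" "g = squarefree_monomial (\<Union>B)"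
      by blast
    then show ?thesis
      using sub fin by (simp add: keys_squarefree_monomial)
  qed
  ultimately show ?thesis
    using Idl_monomials[of "squarefree_monomial ` {\<Union>B | B. bad3_subhypergraph H B}" V] by simp
qed

section \<open>Minimal vertex covers and associated primes\<close>

lemma cover_edge_degree:
  assumes "vertex_cover V H C" "g \<in> edge_monomials H"
  shows "1 \<le> (\<Sum>x\<in>C. lookup g x)"
proof -
  obtain E where E: "E \<in> H" "g = squarefree_monomial E"
    using assms(2) by (auto simp: edge_monomials_def)
  have "finite C" "C \<inter> E \<noteq> {}"
    using assms(1) E(1) finite_V finite_subset by (auto simp: vertex_cover_def)
  then show ?thesis
    using E finite_edge by (simp add: sum_lookup_squarefree_monomial Suc_le_eq card_gt_0_iff)
qed

text \<open>An edge left uncovered by removing \<open>x\<close> meets \<open>C\<close> only in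
  \<open>x\<close>. These private edges are the form in which minimality of a cover is used.\<close>

lemma minimal_cover_edge:
  assumes "vertex_cover V H C" "x \<in> C" "\<And>C'. vertex_cover V H C' \<Longrightarrow> C' \<subseteq> C \<Longrightarrow> C' = C"
  shows "\<exists>E\<in>H. E \<subseteq> insert x (V - C)"
proof -
  have "\<not> vertex_cover V H (C - {x})"
    using assms(3)[of "C - {x}"] assms(2) by blast
  then obtain E where "E \<in> H" "(C - {x}) \<inter> E = {}"
    using assms(1) by (auto simp: vertex_cover_def)
  then show ?thesis
    using edge_subset by blast
qed

text \<open>Write \<open>p = I : g\<close> and let \<open>C\<close> collect the variables in
  \<open>p\<close>. Primality makes \<open>C\<close> a cover and keeps the product of the remaining
  variables out of \<open>p\<close>. Private edges come from a term \<open>n\<close> of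
  \<open>g\<close> outside \<open>I\<close>: for \<open>x\<close> in \<open>C\<close>, an edge
  divides \<open>n\<close> times \<open>x\<close>, and \<open>n\<close> involves no variable of
  \<open>C\<close>. The product of the remaining variables later serves to build a
  denominator.\<close>

lemma associated_prime_edge_ideal:
  fixes p :: "(('v \<Rightarrow>\<^sub>0 nat) \<Rightarrow>\<^sub>0 'k::field) set"
  assumes "p \<in> associated_primes (mpoly_ring V) (edge_ideal V H)"
  obtains C where "vertex_cover V H C" "\<And>x. x \<in> C \<Longrightarrow> \<exists>E\<in>H. E \<subseteq> insert x (V - C)"
    "single (squarefree_monomial (V - C)) 1 \<notin> p"
proof -
  let ?I = "edge_ideal V H :: (('v \<Rightarrow>\<^sub>0 nat) \<Rightarrow>\<^sub>0 'k) set"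
  have "ideal ?I (mpoly_ring V)"
    by (simp add: edge_ideal_eq ideal_monomial_ideal)
  then obtain g where prime: "primeideal p (mpoly_ring V)" and g: "g \<in> carrier (mpoly_ring V)"
    and p: "p = {r \<in> carrier (mpoly_ring V). r * g \<in> ?I}"
    using assms mpoly.associated_primes_iff by blast
  interpret p: primeideal p "mpoly_ring V" by (rule prime)
  have one: "1 \<notin> p"
    using p.one_imp_carrier p.I_notcarr by auto
  define C where "C = {x\<in>V. mpoly_var x \<in> p}"
  have prod_mem: "\<exists>x\<in>E. mpoly_var x \<in> p"
    if "finite E" "E \<subseteq> V" "(\<Prod>x\<in>E. mpoly_var x) \<in> p" for E
    using that
  proof (induction rule: finite_induct)
    case empty
    then show ?case using one by simp
  next
    case (insert x E)
    have "mpoly_var x \<in> carrier (mpoly_ring V)" "(\<Prod>x\<in>E. mpoly_var x) \<in> carrier (mpoly_ring V)"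
      using insert by (simp_all add: prod_mpoly_var keys_squarefree_monomial carrier_mpoly_ring)
        (simp add: mpoly_var_def)
    then show ?case
      using p.I_prime[of "mpoly_var x" "\<Prod>x\<in>E. mpoly_var x"] insert by auto
  qed
  have "1 * g \<notin> ?I"
    using one p mpoly.type_closed(3) by blast
  \<comment> \<open>Since \<open>I\<close> is a monomial ideal, \<open>g\<close> lies outside it
    because of some single term \<open>n\<close>, and \<open>x * g\<close> in \<open>I\<close>
    forces the term \<open>n\<close> times \<open>x\<close> into \<open>I\<close>.\<close>
  then obtain n where n: "n \<in> keys g" and no_edge: "\<And>e. e \<in> edge_monomials H \<Longrightarrow> \<not> e \<preceq> n"
    using g by (simp add: edge_ideal_eq monomial_ideal_def carrier_mpoly_ring) blast
  have C_edge: "\<exists>E\<in>H. squarefree_monomial E \<preceq> n + single x 1" if "x \<in> C" for x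
  proof -
    have "mpoly_var x \<in> p"
      using that by (simp add: C_def)
    then have "mpoly_var x * g \<in> ?I"
      by (subst (asm) p) simp
    then have "g * single (single x 1) 1 \<in> ?I"
      by (simp add: mpoly_var_def mult.commute)
    moreover have "n + single x 1 \<in> keys (g * single (single x 1) 1)"
      using n by (auto simp: keys_mult_monomial)
    ultimately show ?thesis
      by (auto simp: edge_ideal_eq monomial_ideal_def edge_monomials_def)
  qed
  text \<open>The edge ideal is squarefree, so no variable of \<open>n\<close> lies in \<open>C\<close>.\<close>
  have n_C: "lookup n z = 0" if "z \<in> C" for z
  proof (rule ccontr)
    assume z: "lookup n z \<noteq> 0"
    obtain E where E: "E \<in> H" "squarefree_monomial E \<preceq> n + single z 1"
      using C_edge[OF \<open>z \<in> C\<close>] by blast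
    have "1 \<le> lookup n x" if "x \<in> E" for x
    proof (cases "x = z")
      case False
      have "1 \<le> lookup (n + single z 1) x"
        using E that squarefree_monomial_dvd_iff[OF finite_edge] by blast
      with False show ?thesis
        by (simp add: lookup_add lookup_single)
    qed (use z in simp)
    then show False
      using no_edge[of "squarefree_monomial E"] E(1) squarefree_monomial_dvd_iff[OF finite_edge]
      by (simp add: edge_monomials_def)
  qed
  show ?thesis
  proof (rule that)
    show "vertex_cover V H C"
      unfolding vertex_cover_def
    proof (intro conjI ballI)
      fix E assume E: "E \<in> H"
      have "single (squarefree_monomial E) 1 * g \<in> ?I"
        using ideal.I_r_closed[OF \<open>ideal ?I (mpoly_ring V)\<close>, of "single (squarefree_monomial E) 1" g]
          E g finite_edge edge_subset
        by (auto simp: edge_ideal_eq keys_squarefree_monomial edge_monomials_def)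
      then have "(\<Prod>x\<in>E. mpoly_var x) \<in> p"
        using E finite_edge edge_subset
        by (auto simp: p prod_mpoly_var carrier_mpoly_ring keys_squarefree_monomial)
      then show "C \<inter> E \<noteq> {}"
        using prod_mem[of E] E finite_edge edge_subset by (auto simp: C_def)
    qed (auto simp: C_def)
    show "\<exists>E\<in>H. E \<subseteq> insert x (V - C)" if x: "x \<in> C" for x
    proof -
      obtain E where E: "E \<in> H" "squarefree_monomial E \<preceq> n + single x 1"
        using C_edge[OF x] by blast
      have "y \<notin> C" if "y \<in> E" "y \<noteq> x" for y
      proof -
        have "1 \<le> lookup (n + single x 1) y"
          using E that(1) squarefree_monomial_dvd_iff[OF finite_edge] by blast
        with that(2) show ?thesis
          using n_C[of y] by (auto simp: lookup_add lookup_single)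
      qed
      then show ?thesis
        using E(1) edge_subset[OF E(1)] by blast
    qed
    show "single (squarefree_monomial (V - C)) 1 \<notin> p"
      using prod_mem[of "V - C"] finite_V by (auto simp: prod_mpoly_var C_def)
  qed
qed

text \<open>\<open>Q\<close> is the colon ideal \<open>I : u\<close> for \<open>u\<close> the
  product of the variables outside \<open>C\<close>. The private edge of \<open>x\<close> divides
  \<open>x\<close> times \<open>u\<close>, while an edge dividing \<open>n\<close> times
  \<open>u\<close> meets \<open>C\<close> in a variable that must occur in \<open>n\<close>.
  Primality is \<open>order_of_product\<close> for the bound 1 and the degree in
  \<open>C\<close>.\<close>

lemma minimal_cover_associated_prime:
  fixes C :: "'v set"
  defines "Q \<equiv> monomial_ideal V ((\<lambda>x. single x 1) ` C) :: (('v \<Rightarrow>\<^sub>0 nat) \<Rightarrow>\<^sub>0 'k::field) set"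
  assumes "vertex_cover V H C" and min: "\<And>C'. vertex_cover V H C' \<Longrightarrow> C' \<subseteq> C \<Longrightarrow> C' = C"
  shows "Q \<in> associated_primes (mpoly_ring V) (edge_ideal V H)"
    and "\<And>r. r \<in> Q \<longleftrightarrow> r \<in> carrier (mpoly_ring V) \<and> (\<forall>n\<in>keys r. 1 \<le> (\<Sum>x\<in>C. lookup n x))"
proof -
  let ?I = "edge_ideal V H :: (('v \<Rightarrow>\<^sub>0 nat) \<Rightarrow>\<^sub>0 'k) set"
  let ?u = "squarefree_monomial (V - C)"
  have C: "C \<subseteq> V" "finite C"
    using assms(2) finite_V finite_subset by (auto simp: vertex_cover_def)
  have single_dvd: "single x 1 \<preceq> n \<longleftrightarrow> 1 \<le> lookup n x" for x and n :: "'v \<Rightarrow>\<^sub>0 nat"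
    by (auto simp: lookup_single when_def)
  have deg_iff: "1 \<le> (\<Sum>x\<in>C. lookup n x) \<longleftrightarrow> (\<exists>x\<in>C. 1 \<le> lookup n x)" for n :: "'v \<Rightarrow>\<^sub>0 nat"
    using C(2) by (metis (no_types, lifting) One_nat_def Suc_le_eq bot_nat_0.not_eq_extremum
        sum_eq_0_iff)
  show Q_iff: "r \<in> Q \<longleftrightarrow> r \<in> carrier (mpoly_ring V) \<and> (\<forall>n\<in>keys r. 1 \<le> (\<Sum>x\<in>C. lookup n x))" for r
    unfolding deg_iff Q_def monomial_ideal_def carrier_mpoly_ring mem_Collect_eq bex_simps
      single_dvd by blast
  have ideal_Q: "ideal Q (mpoly_ring V)"
    unfolding Q_def by (rule ideal_monomial_ideal)
  have "primeideal Q (mpoly_ring V)"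
  proof (rule primeidealI[OF ideal_Q mpoly.is_cring])
    have "1 \<notin> Q" by (simp add: Q_iff)
    then show "carrier (mpoly_ring V) \<noteq> Q"
      using mpoly.type_closed(3) by blast
    fix a b :: "('v \<Rightarrow>\<^sub>0 nat) \<Rightarrow>\<^sub>0 'k"
    assume ab: "a \<in> carrier (mpoly_ring V)" "b \<in> carrier (mpoly_ring V)"
      "a \<otimes>\<^bsub>mpoly_ring V\<^esub> b \<in> Q"
    have "b \<in> Q" if "a \<notin> Q"
    proof -
      have "1 \<le> (\<Sum>x\<in>C. lookup m x)" if "m \<in> keys b" for m
      proof (rule order_of_product[where s = a and a = b])
        show "\<exists>m\<in>keys a. (\<Sum>x\<in>C. lookup m x) = 0"
          using \<open>a \<notin> Q\<close> ab(1) by (force simp: Q_iff)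
      qed (use ab that in \<open>auto simp: Q_iff lookup_add sum.distrib\<close>)
      then show ?thesis
        using ab by (auto simp: Q_iff)
    qed
    then show "a \<in> Q \<or> b \<in> Q" by blast
  qed
  moreover have "Q = {r \<in> carrier (mpoly_ring V). r * single ?u 1 \<in> ?I}"
  proof -
    have "(\<exists>E\<in>H. squarefree_monomial E \<preceq> n + ?u) \<longleftrightarrow> (\<exists>x\<in>C. 1 \<le> lookup n x)"
      for n :: "'v \<Rightarrow>\<^sub>0 nat"
    proof
      assume "\<exists>E\<in>H. squarefree_monomial E \<preceq> n + ?u"
      then obtain E where E: "E \<in> H" "squarefree_monomial E \<preceq> n + ?u" by blast
      obtain x where x: "x \<in> C" "x \<in> E"
        using assms(2) E(1) by (auto simp: vertex_cover_def)
      have "1 \<le> lookup (n + ?u) x"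
        using E x finite_edge by (auto simp: squarefree_monomial_dvd_iff)
      then show "\<exists>x\<in>C. 1 \<le> lookup n x"
        using x finite_V by (auto simp: lookup_add lookup_squarefree_monomial)
    next
      assume "\<exists>x\<in>C. 1 \<le> lookup n x"
      then obtain x where x: "x \<in> C" "1 \<le> lookup n x" by blast
      obtain E where E: "E \<in> H" "E \<subseteq> insert x (V - C)"
        using minimal_cover_edge[OF assms(2) x(1) min] by blast
      have "squarefree_monomial E \<preceq> n + ?u"
        unfolding squarefree_monomial_dvd_iff[OF finite_edge[OF E(1)]]
        using E x finite_V by (auto simp: lookup_add lookup_squarefree_monomial)
      with E show "\<exists>E\<in>H. squarefree_monomial E \<preceq> n + ?u" by blast
    qed
    moreover have "r * single ?u 1 \<in> ?I \<longleftrightarrow>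
        (\<forall>n\<in>keys r. \<exists>E\<in>H. squarefree_monomial E \<preceq> n + ?u)"
      if "r \<in> carrier (mpoly_ring V)" for r
      using that finite_V
      by (simp add: edge_ideal_eq monomial_ideal_def keys_mult_monomial
          edge_monomials_def carrier_mpoly_ring keys_plus_nat keys_squarefree_monomial Diff_subset)
    ultimately have "r \<in> Q \<longleftrightarrow> r \<in> carrier (mpoly_ring V) \<and> r * single ?u 1 \<in> ?I" for r
      unfolding Q_iff deg_iff by metis
    then show ?thesis by blast
  qed
  moreover have "single ?u 1 \<in> carrier (mpoly_ring V)"
    using finite_V by (auto simp: carrier_mpoly_ring keys_squarefree_monomial)
  ultimately show "Q \<in> associated_primes (mpoly_ring V) ?I"
    using mpoly.associated_primes_iff[of ?I V Q] ideal_monomial_ideal[of V "edge_monomials H"]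
    by (auto simp: edge_ideal_eq)
qed

lemma symbolic_square_edge_ideal:
  "symbolic_power (mpoly_ring V) (edge_ideal V H :: (('v \<Rightarrow>\<^sub>0 nat) \<Rightarrow>\<^sub>0 'k::field) set) 2 =
    {a \<in> carrier (mpoly_ring V). \<forall>m\<in>keys a. \<forall>C. vertex_cover V H C \<longrightarrow> 2 \<le> (\<Sum>x\<in>C. lookup m x)}"
proof (intro Set.set_eqI iffI)
  let ?I = "edge_ideal V H :: (('v \<Rightarrow>\<^sub>0 nat) \<Rightarrow>\<^sub>0 'k) set"
  let ?R = "mpoly_ring V"
  let ?G = "{g + h | g h. g \<in> edge_monomials H \<and> h \<in> edge_monomials H}"
  have symbolic: "a \<in> symbolic_power ?R ?I 2 \<longleftrightarrow> a \<in> carrier ?R \<and>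
      (\<forall>p\<in>associated_primes ?R ?I. \<exists>s\<in>carrier ?R - p. s * a \<in> monomial_ideal V ?G)" for a
    using mpoly.symbolic_power_iff[of ?I V 2 a]
    by (simp add: edge_ideal_squared ideal_monomial_ideal) (simp add: edge_ideal_eq ideal_monomial_ideal)
  fix a :: "('v \<Rightarrow>\<^sub>0 nat) \<Rightarrow>\<^sub>0 'k"
  {
    assume a: "a \<in> symbolic_power ?R ?I 2"
    have "2 \<le> (\<Sum>x\<in>D. lookup m x)" if m: "m \<in> keys a" and D: "vertex_cover V H D" for m D
    proof -
      have finD: "finite D"
        using D finite_V finite_subset by (auto simp: vertex_cover_def)
      \<comment> \<open>Associated primes are available for minimal covers, so \<open>D\<close> is
        shrunk to a minimal cover \<open>C\<close>; the degree in \<open>D\<close> is at least the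
        degree in \<open>C\<close>.\<close>
      let ?covers = "{C\<in>Pow D. vertex_cover V H C}"
      have "finite ?covers" "D \<in> ?covers"
        using finD D by simp_all
      from finite_has_minimal2[OF this] obtain C where "C \<in> ?covers"
        and minimal: "\<forall>C'\<in>?covers. C' \<subseteq> C \<longrightarrow> C = C'"
        by (elim bexE conjE)
      then have C: "vertex_cover V H C" "C \<subseteq> D" by auto
      have min: "C' = C" if "vertex_cover V H C'" "C' \<subseteq> C" for C'
        using minimal that C(2) by auto
      define Q where "Q = (monomial_ideal V ((\<lambda>x. single x 1) ` C)
        :: (('v \<Rightarrow>\<^sub>0 nat) \<Rightarrow>\<^sub>0 'k) set)"
      have "Q \<in> associated_primes ?R ?I"
        unfolding Q_def by (rule minimal_cover_associated_prime(1)[OF C(1) min])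
      then obtain s where s: "s \<in> carrier ?R" "s \<notin> Q" "s * a \<in> monomial_ideal V ?G"
        using a symbolic by blast
      have "2 \<le> (\<Sum>x\<in>C. lookup m x)"
      proof (rule order_of_product[where s = s and a = a])
        \<comment> \<open>Lying outside \<open>Q\<close> means having a term free of the variables
          of \<open>C\<close>, which is what \<open>order_of_product\<close> asks of the factor
          \<open>s\<close>.\<close>
        have "\<exists>n\<in>keys s. \<not> 1 \<le> (\<Sum>x\<in>C. lookup n x)"
          using minimal_cover_associated_prime(2)[OF C(1) min, of s] s(1,2) unfolding Q_def by blast
        then show "\<exists>n\<in>keys s. (\<Sum>x\<in>C. lookup n x) = 0"
          by (meson less_one not_le)
        show "2 \<le> (\<Sum>x\<in>C. lookup n x)" if n: "n \<in> keys (s * a)" for n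
        proof -
          obtain g h where gh: "g \<in> edge_monomials H" "h \<in> edge_monomials H" "g + h \<preceq> n"
            using s(3) n unfolding monomial_ideal_def by blast
          have "2 \<le> (\<Sum>x\<in>C. lookup (g + h) x)"
            using cover_edge_degree[OF C(1) gh(1)] cover_edge_degree[OF C(1) gh(2)]
            by (simp add: lookup_add sum.distrib)
          also have "\<dots> \<le> (\<Sum>x\<in>C. lookup n x)"
            using gh(3) by (intro sum_mono) blast
          finally show ?thesis .
        qed
      qed (use m in \<open>simp_all add: lookup_add sum.distrib\<close>)
      also have "\<dots> \<le> (\<Sum>x\<in>D. lookup m x)"
        using C(2) finD by (intro sum_mono2) auto
      finally show ?thesis .
    qed
    then show "a \<in> {a \<in> carrier ?R. \<forall>m\<in>keys a. \<forall>C. vertex_cover V H C \<longrightarrow>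
        2 \<le> (\<Sum>x\<in>C. lookup m x)}"
      using a symbolic by blast
  }
  assume "a \<in> {a \<in> carrier ?R. \<forall>m\<in>keys a. \<forall>C. vertex_cover V H C \<longrightarrow>
      2 \<le> (\<Sum>x\<in>C. lookup m x)}"
  then have a: "a \<in> carrier ?R"
    and deg: "\<And>m C. m \<in> keys a \<Longrightarrow> vertex_cover V H C \<Longrightarrow> 2 \<le> (\<Sum>x\<in>C. lookup m x)"
    by auto
  have "\<exists>s\<in>carrier ?R - p. s * a \<in> monomial_ideal V ?G" if p: "p \<in> associated_primes ?R ?I" for p
  proof -
    obtain C where C: "vertex_cover V H C" "\<And>x. x \<in> C \<Longrightarrow> \<exists>E\<in>H. E \<subseteq> insert x (V - C)"
      and t: "single (squarefree_monomial (V - C)) 1 \<notin> p"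
      using associated_prime_edge_ideal[OF p] by blast
    let ?u = "squarefree_monomial (V - C)"
    let ?t = "single ?u (1::'k)"
    have finC: "finite C"
      using C(1) finite_V finite_subset by (auto simp: vertex_cover_def)
    have "primeideal p ?R"
      using p by (simp add: associated_primes_def)
    moreover have t_carrier: "?t \<in> carrier ?R"
      using finite_V by (auto simp: carrier_mpoly_ring keys_squarefree_monomial)
    \<comment> \<open>The denominator is a square because two edges have to be completed: the
      private edges of \<open>x\<close> and \<open>y\<close> divide \<open>x\<close> times
      \<open>u\<close> and \<open>y\<close> times \<open>u\<close>.\<close>
    ultimately have "?t * ?t \<in> carrier ?R - p"
      using t primeideal.I_prime[of p ?R ?t ?t] mpoly.type_closed(1)[of ?t V ?t] by auto
    moreover have "?t * ?t * a \<in> monomial_ideal V ?G"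
    proof -
      have "\<exists>g\<in>?G. g \<preceq> m + (?u + ?u)" if m: "m \<in> keys a" for m
      proof -
        have two: "2 \<le> (\<Sum>x\<in>C. lookup m x)"
          using deg[OF m C(1)] .
        then have "(\<Sum>x\<in>C. lookup m x) \<noteq> 0" by simp
        then obtain x where "x \<in> C" "lookup m x \<noteq> 0"
          by (meson sum.neutral)
        then have x: "x \<in> C" "1 \<le> lookup m x" by simp_all
        \<comment> \<open>\<open>y\<close> is \<open>x\<close> itself when \<open>m\<close> has
          exponent at least 2 there; otherwise the remaining degree comes from another vertex of
          \<open>C\<close>.\<close>
        obtain y where y: "y \<in> C" "single x 1 + single y 1 \<preceq> m"
        proof (cases "2 \<le> lookup m x")
          case True
          then show ?thesis
            using that[of x] x by (auto simp: lookup_add lookup_single when_def)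
        next
          case False
          have "(\<Sum>y\<in>C. lookup m y) = lookup m x + (\<Sum>y\<in>C - {x}. lookup m y)"
            using x finC by (simp add: sum.remove)
          with two False have "(\<Sum>y\<in>C - {x}. lookup m y) \<noteq> 0" by simp
          then obtain y where y: "y \<in> C - {x}" "lookup m y \<noteq> 0"
            by (meson sum.neutral)
          then have "single x 1 + single y 1 \<preceq> m"
            using x by (auto simp: lookup_add lookup_single when_def)
          then show ?thesis
            using that[of y] y by blast
        qed
        obtain E F where EF: "E \<in> H" "E \<subseteq> insert x (V - C)" "F \<in> H" "F \<subseteq> insert y (V - C)"
          using C(2) x(1) y(1) by metis
        have "squarefree_monomial E + squarefree_monomial F \<preceq> m + (?u + ?u)"
        proof
          fix z
          have "lookup (squarefree_monomial E) z \<le> lookup (single x 1) z + lookup ?u z"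
            "lookup (squarefree_monomial F) z \<le> lookup (single y 1) z + lookup ?u z"
            using EF finite_edge finite_V
            by (auto simp: lookup_squarefree_monomial lookup_single when_def)
          moreover have "lookup (single x 1) z + lookup (single y 1) z \<le> lookup m z"
            using y(2) by (simp add: lookup_add)
          ultimately show "lookup (squarefree_monomial E + squarefree_monomial F) z
              \<le> lookup (m + (?u + ?u)) z"
            unfolding lookup_add by linarith
        qed
        with EF show ?thesis
          by (auto simp: edge_monomials_def)
      qed
      moreover have "?t * ?t * a = a * single (?u + ?u) 1"
        by (simp add: mult_single mult.commute)
      ultimately show ?thesis
        using a finite_V
        by (auto simp: monomial_ideal_def keys_mult_monomial keys_plus_nat carrier_mpoly_ring
            keys_squarefree_monomial)
    qed
    ultimately show ?thesis by blast
  qed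
  then show "a \<in> symbolic_power ?R ?I 2"
    using a symbolic by blast
qed

end

theorem corollary3p16:
  fixes V :: "'v set" and H :: "'v set set"
    and I :: "(('v \<Rightarrow>\<^sub>0 nat) \<Rightarrow>\<^sub>0 'k :: field) set"
  assumes "simple_hypergraph V H"
    and "uniform_hypergraph 3 H"
    and "partite_hypergraph 3 V H"
    and "I = edge_ideal V H"
  shows "symbolic_power (mpoly_ring V) I 2 =
         ideal_power (mpoly_ring V) I 2 <+>\<^bsub>mpoly_ring V\<^esub>
         Idl\<^bsub>mpoly_ring V\<^esub> {\<Prod>x\<in>\<Union>B. mpoly_var x | B. bad3_subhypergraph H B}"
proof -
  let ?G = "{g + h | g h. g \<in> edge_monomials H \<and> h \<in> edge_monomials H}"
  let ?B = "squarefree_monomial ` {\<Union>B | B. bad3_subhypergraph H B}"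
  \<comment> \<open>Both sides of the theorem are determined by conditions on single monomials, so
    only this equivalence of exponent conditions remains.\<close>
  have "(\<forall>C. vertex_cover V H C \<longrightarrow> 2 \<le> (\<Sum>x\<in>C. lookup m x)) \<longleftrightarrow> (\<exists>g\<in>?G \<union> ?B. g \<preceq> m)" for m
  proof
    assume "\<forall>C. vertex_cover V H C \<longrightarrow> 2 \<le> (\<Sum>x\<in>C. lookup m x)"
    then have "(\<exists>e\<in>H. \<exists>f\<in>H. squarefree_monomial e + squarefree_monomial f \<preceq> m) \<or>
        (\<exists>B. bad3_subhypergraph H B \<and> squarefree_monomial (\<Union>B) \<preceq> m)"
      using degree_two_divides[OF assms(1,3)] by blast
    then show "\<exists>g\<in>?G \<union> ?B. g \<preceq> m"
      unfolding edge_monomials_def by blast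
  next
    assume "\<exists>g\<in>?G \<union> ?B. g \<preceq> m"
    then obtain g where g: "g \<in> ?G \<union> ?B" "g \<preceq> m" by blast
    show "\<forall>C. vertex_cover V H C \<longrightarrow> 2 \<le> (\<Sum>x\<in>C. lookup m x)"
    proof (intro allI impI)
      fix C assume C: "vertex_cover V H C"
      then have finC: "finite C"
        using finite_V[OF assms(1)] finite_subset by (auto simp: vertex_cover_def)
      have "2 \<le> (\<Sum>x\<in>C. lookup g x)"
        using g(1)
      proof
        assume "g \<in> ?G"
        then obtain e f where ef: "g = e + f" "e \<in> edge_monomials H" "f \<in> edge_monomials H"
          by blast
        show ?thesis
          using cover_edge_degree[OF assms(1) C ef(2)] cover_edge_degree[OF assms(1) C ef(3)]
          by (simp add: ef(1) lookup_add sum.distrib)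
      next
        assume "g \<in> ?B"
        then obtain B where B: "g = squarefree_monomial (\<Union>B)" "bad3_subhypergraph H B"
          by blast
        have "\<Union>B \<subseteq> V"
          using bad3_subhypergraph_subset[OF B(2)] edge_subset[OF assms(1)] by blast
        then have "finite (\<Union>B)"
          using finite_V[OF assms(1)] by (rule finite_subset)
        then show ?thesis
          using cover_bad3[OF C B(2) finC] finC by (simp add: B(1) sum_lookup_squarefree_monomial)
      qed
      also have "\<dots> \<le> (\<Sum>x\<in>C. lookup m x)"
        using g(2) by (intro sum_mono) blast
      finally show "2 \<le> (\<Sum>x\<in>C. lookup m x)" .
    qed
  qed
  then show ?thesis
    unfolding assms(4) symbolic_square_edge_ideal[OF assms(1)] edge_ideal_squared[OF assms(1)]
      bad3_ideal_eq[OF assms(1)] set_add_monomial_ideal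
    by (auto simp: monomial_ideal_def carrier_mpoly_ring)
qed

end
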